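(* Let $a,b,c\in\mathbb C$ and $d\in\mathbb N$ be such that the $\Re$-module $R_d(a,b,c)$ is irreducible. Then the following are equivalent: (i) $A,B,C$ act on $R_d(a,b,c)$ as a Leonard triple; (ii) $A,B,C$ are each diagonalizable on $R_d(a,b,c)$; (iii) none of $a,b,c$ belongs to $\{\frac{i-d-1}{2}\mid i=1,2,\dots,2d-1\}$.
   Context: $\Re$ is the unital associative $\mathbb C$-algebra generated by $A,B,C,\Delta$ with $[A,B]=[B,C]=[C,A]=2\Delta$ and such that $\alpha=[A,\Delta]+AC-BA$, $\beta=[B,\Delta]+BA-CB$, $\gamma=[C,\Delta]+CB-AC$ are central; $\delta=A+B+C$. For $a,b,c\in\mathbb C$, $d\in\mathbb N$, $R_d(a,b,c)$ denotes the $(d+1)$-dimensional $\Re$-module (known to exist, determined up to isomorphism by these data) having a basis with respect to which $A$ is the lower bidiagonal matrix with diagonal $\theta_i=(a+\frac d2-i)(a+\frac d2-i+1)$ ($0\le i\le d$) and subdiagonal entries $1$; $B$ is the upper bidiagonal matrix with diagonal $\theta^*_i=(b+\frac d2-i)(b+\frac d2-i+1)$ and superdiagonal $\varphi_i=i(i-d-1)(a+b+c+\frac d2-i+2)(a+b-c+\frac d2-i+1)$ ($1\le i\le d$); and $\alpha,\beta,\gamma,\delta$ act as the scalars $(c-b)(c+b+1)(a-\frac d2)(a+\frac d2+1)$, $(a-c)(a+c+1)(b-\frac d2)(b+\frac d2+1)$, $(b-a)(b+a+1)(c-\frac d2)(c+\frac d2+1)$, $\frac d2(\frac d2+1)+a(a+1)+b(b+1)+c(c+1)$.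 A square matrix is tridiagonal if every nonzero entry lies on the diagonal, subdiagonal or superdiagonal, and irreducible tridiagonal if moreover all sub- and superdiagonal entries are nonzero. An ordered triple $L,L^*,L^\varepsilon$ of linear operators on a finite-dimensional nonzero space $V$ is a Leonard triple if for each of the three operators there is a basis of $V$ in which that operator is diagonal and the other two are irreducible tridiagonal. *)

theory Defs
  imports "Jordan_Normal_Form.Matrix"
begin

text \<open>The module R_d(a,b,c) on C^(d+1), given by the matrices of A, B, C, Delta
  in the distinguished basis. Indices run over 0..d (rows/columns 0..d).\<close>

definition theta :: "complex \<Rightarrow> nat \<Rightarrow> nat \<Rightarrow> complex" where
  "theta a d i = (a + of_nat d / 2 - of_nat i) * (a + of_nat d / 2 - of_nat i + 1)"

definition phi :: "complex \<Rightarrow> complex \<Rightarrow> complex \<Rightarrow> nat \<Rightarrow> nat \<Rightarrow> complex" where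
  "phi a b c d i = of_nat i * (of_nat i - of_nat d - 1)
      * (a + b + c + of_nat d / 2 - of_nat i + 2) * (a + b - c + of_nat d / 2 - of_nat i + 1)"

definition deltaR :: "complex \<Rightarrow> complex \<Rightarrow> complex \<Rightarrow> nat \<Rightarrow> complex" where
  "deltaR a b c d = (of_nat d / 2) * (of_nat d / 2 + 1) + a * (a + 1) + b * (b + 1) + c * (c + 1)"

definition RA :: "complex \<Rightarrow> complex \<Rightarrow> complex \<Rightarrow> nat \<Rightarrow> complex mat" where
  "RA a b c d = mat (d+1) (d+1) (\<lambda>(i,j). if i = j then theta a d i else if i = j + 1 then 1 else 0)"

definition RB :: "complex \<Rightarrow> complex \<Rightarrow> complex \<Rightarrow> nat \<Rightarrow> complex mat" where
  "RB a b c d = mat (d+1) (d+1) (\<lambda>(i,j). if i = j then theta b d i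
       else if j = i + 1 then phi a b c d j else 0)"

text \<open>delta = A + B + C acts as the scalar deltaR, so C acts as deltaR I - A - B.\<close>
definition RC :: "complex \<Rightarrow> complex \<Rightarrow> complex \<Rightarrow> nat \<Rightarrow> complex mat" where
  "RC a b c d = deltaR a b c d \<cdot>\<^sub>m 1\<^sub>m (d+1) - RA a b c d - RB a b c d"

definition RDelta :: "complex \<Rightarrow> complex \<Rightarrow> complex \<Rightarrow> nat \<Rightarrow> complex mat" where
  "RDelta a b c d = (1/2 :: complex) \<cdot>\<^sub>m (RA a b c d * RB a b c d - RB a b c d * RA a b c d)"

definition is_subspace :: "nat \<Rightarrow> complex vec set \<Rightarrow> bool" where
  "is_subspace n W \<longleftrightarrow> W \<subseteq> carrier_vec n \<and> 0\<^sub>v n \<in> W \<and>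
     (\<forall>u\<in>W. \<forall>v\<in>W. u + v \<in> W) \<and> (\<forall>k. \<forall>u\<in>W. k \<cdot>\<^sub>v u \<in> W)"

definition invariant_under :: "complex mat \<Rightarrow> complex vec set \<Rightarrow> bool" where
  "invariant_under M W \<longleftrightarrow> (\<forall>v\<in>W. M *\<^sub>v v \<in> W)"

definition R_irreducible :: "complex \<Rightarrow> complex \<Rightarrow> complex \<Rightarrow> nat \<Rightarrow> bool" where
  "R_irreducible a b c d \<longleftrightarrow>
     (\<forall>W. is_subspace (d+1) W \<and> invariant_under (RA a b c d) W \<and> invariant_under (RB a b c d) W
        \<and> invariant_under (RC a b c d) W \<and> invariant_under (RDelta a b c d) W
        \<longrightarrow> W = {0\<^sub>v (d+1)} \<or> W = carrier_vec (d+1))"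

definition tridiagonal :: "complex mat \<Rightarrow> bool" where
  "tridiagonal M \<longleftrightarrow> (\<forall>i<dim_row M. \<forall>j<dim_col M. M $$ (i,j) \<noteq> 0 \<longrightarrow> i \<le> j + 1 \<and> j \<le> i + 1)"

definition irred_tridiagonal :: "complex mat \<Rightarrow> bool" where
  "irred_tridiagonal M \<longleftrightarrow> tridiagonal M \<and>
     (\<forall>i. i + 1 < dim_row M \<longrightarrow> M $$ (i+1, i) \<noteq> 0 \<and> M $$ (i, i+1) \<noteq> 0)"

text \<open>Change of basis: columns of P form the new basis, Q = P^{-1};
  the matrix of the operator M in the new basis is Q * M * P.\<close>
definition basis_change :: "nat \<Rightarrow> complex mat \<Rightarrow> complex mat \<Rightarrow> bool" where
  "basis_change n P Q \<longleftrightarrow> P \<in> carrier_mat n n \<and> Q \<in> carrier_mat n n \<and> P * Q = 1\<^sub>m n \<and> Q * P = 1\<^sub>m n"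

definition diagonalizable :: "nat \<Rightarrow> complex mat \<Rightarrow> bool" where
  "diagonalizable n M \<longleftrightarrow> (\<exists>P Q. basis_change n P Q \<and> diagonal_mat (Q * M * P))"

definition leonard_triple :: "nat \<Rightarrow> complex mat \<Rightarrow> complex mat \<Rightarrow> complex mat \<Rightarrow> bool" where
  "leonard_triple n L1 L2 L3 \<longleftrightarrow> 0 < n \<and>
     (\<exists>P Q. basis_change n P Q \<and> diagonal_mat (Q * L1 * P)
        \<and> irred_tridiagonal (Q * L2 * P) \<and> irred_tridiagonal (Q * L3 * P)) \<and>
     (\<exists>P Q. basis_change n P Q \<and> diagonal_mat (Q * L2 * P)
        \<and> irred_tridiagonal (Q * L1 * P) \<and> irred_tridiagonal (Q * L3 * P)) \<and>
     (\<exists>P Q. basis_change n P Q \<and> diagonal_mat (Q * L3 * P)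
        \<and> irred_tridiagonal (Q * L1 * P) \<and> irred_tridiagonal (Q * L2 * P))"

definition bad_values :: "nat \<Rightarrow> complex set" where
  "bad_values d = {(of_nat i - of_nat d - 1) / 2 | i::nat. 1 \<le> i \<and> i + 1 \<le> 2 * d}"

end

theory Submission
  imports Defs "Jordan_Normal_Form.Determinant"
begin

text \<open>In the distinguished basis A is lower bidiagonal with subdiagonal entries 1, so its eigenspaces
  are lines and A is diagonalizable iff the \<^term>\<open>theta a d i\<close> are pairwise distinct, i.e. iff a is
  not a bad value. Irreducibility forces \<^term>\<open>phi a b c d i \<noteq> 0\<close>, so the same argument applies to the
  transpose of B. For C it applies in the basis of the chain w_0 = e_0, w_(i+1) = (C - theta c d i) w_i.

  Each ordered pair (X,Y) among (A,B), (B,A), (C,A) satisfies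
  [X,[X,Y]] = 2(XY + YX + X^2 - delta X + const). In an eigenbasis of X the (i,j) entry of Y is
  therefore annihilated by (t_i - t_j)^2 - 2(t_i + t_j) for i \<noteq> j, which for good parameters vanishes
  only if |i - j| = 1. So Y is tridiagonal, and a vanishing sub- or superdiagonal entry would produce
  an invariant subspace.\<close>

section \<open>Matrices acting on vectors\<close>

lemma mult_mat_unit_vec:
  fixes A :: "'a :: semiring_1 mat"
  shows "A \<in> carrier_mat n m \<Longrightarrow> i < m \<Longrightarrow> A *\<^sub>v unit_vec m i = col A i"
  by (intro eq_vecI) auto

lemma mult_mat_vec_index:
  assumes "A \<in> carrier_mat n m" "v \<in> carrier_vec m" "k < n"
  shows "(A *\<^sub>v v) $ k = (\<Sum>l\<in>{0..<m}. A $$ (k,l) * v $ l)"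
  using assms by (auto simp: scalar_prod_def)

lemma mat_diag_mult_vec:
  fixes e :: "nat \<Rightarrow> 'a :: semiring_1"
  assumes "v \<in> carrier_vec n"
  shows "mat_diag n e *\<^sub>v v = vec n (\<lambda>i. e i * v $ i)"
  using assms
  by (intro eq_vecI)
    (auto simp: mat_diag_def scalar_prod_def if_distrib[of "\<lambda>x. x * _"] cong: if_cong)

lemma smult_mat_mult_vec:
  fixes A :: "'a :: comm_semiring_0 mat"
  assumes "A \<in> carrier_mat n m" "v \<in> carrier_vec m"
  shows "(k \<cdot>\<^sub>m A) *\<^sub>v v = k \<cdot>\<^sub>v (A *\<^sub>v v)"
  using assms
  by (intro eq_vecI) (auto simp: scalar_prod_def sum_distrib_left mult.assoc intro!: sum.cong)

lemma mat_eq_of_mult_vec: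
  fixes X :: "'a :: semiring_1 mat"
  assumes X: "X \<in> carrier_mat n m" and Y: "Y \<in> carrier_mat n m"
    and eq: "\<And>v. v \<in> carrier_vec m \<Longrightarrow> X *\<^sub>v v = Y *\<^sub>v v"
  shows "X = Y"
proof (rule eq_matI)
  fix i j assume "i < dim_row Y" "j < dim_col Y"
  then have "col X j = col Y j"
    using X Y eq[OF unit_vec_carrier, of j] by (simp add: mult_mat_unit_vec)
  then show "X $$ (i,j) = Y $$ (i,j)"
    using \<open>i < dim_row Y\<close> \<open>j < dim_col Y\<close> X Y by (metis carrier_matD index_col)
qed (use X Y in auto)

section \<open>Change of basis\<close>

lemma basis_change_carrier:
  assumes "basis_change n P Q"
  shows "P \<in> carrier_mat n n" "Q \<in> carrier_mat n n"
  using assms by (simp_all add: basis_change_def)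

context
  fixes n :: nat and P Q :: "complex mat"
  assumes PQ: "basis_change n P Q"
begin

private lemmas carrier = basis_change_carrier[OF PQ] mult_carrier_mat[of _ n n _ n]

lemma basis_change_cancel:
  assumes "v \<in> carrier_vec n"
  shows "Q *\<^sub>v (P *\<^sub>v v) = v" "P *\<^sub>v (Q *\<^sub>v v) = v"
  using PQ assms by (simp_all add: basis_change_def flip: assoc_mult_mat_vec[of _ n n _ n])

lemma basis_change_mult_vec_eq_0:
  assumes "v \<in> carrier_vec n" "P *\<^sub>v v = 0\<^sub>v n"
  shows "v = 0\<^sub>v n"
proof -
  have "Q *\<^sub>v 0\<^sub>v n = 0\<^sub>v n" using carrier(2) by (intro eq_vecI) auto
  then show ?thesis using basis_change_cancel(1)[OF assms(1)] assms(2) by simp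
qed

lemma conjugate_carrier: "X \<in> carrier_mat n n \<Longrightarrow> Q * X * P \<in> carrier_mat n n"
  by (simp add: carrier)

lemma conjugate_mult_vec:
  assumes "X \<in> carrier_mat n n" "v \<in> carrier_vec n"
  shows "P *\<^sub>v ((Q * X * P) *\<^sub>v v) = X *\<^sub>v (P *\<^sub>v v)"
proof -
  have Pv: "P *\<^sub>v v \<in> carrier_vec n" "X *\<^sub>v (P *\<^sub>v v) \<in> carrier_vec n"
    using mult_mat_vec_carrier[OF carrier(1) assms(2)] mult_mat_vec_carrier[OF assms(1)] by auto
  have "(Q * X * P) *\<^sub>v v = Q *\<^sub>v (X *\<^sub>v (P *\<^sub>v v))"
    using assms Pv by (simp add: assoc_mult_mat_vec[of _ n n _ n] carrier)
  then show ?thesis using basis_change_cancel(2)[OF Pv(2)] by simp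
qed

lemma conjugate_mult:
  assumes "X \<in> carrier_mat n n" "Y \<in> carrier_mat n n"
  shows "Q * (X * Y) * P = (Q * X * P) * (Q * Y * P)"
proof -
  note [simp] = assoc_mult_mat[of _ n n _ n _ n] carrier
  have "P * (Q * (Y * P)) = (P * Q) * (Y * P)" using assms by simp
  also have "\<dots> = Y * P" using PQ assms by (simp add: basis_change_def)
  finally show ?thesis using assms by simp
qed

lemma conjugate_add:
  assumes "X \<in> carrier_mat n n" "Y \<in> carrier_mat n n"
  shows "Q * (X + Y) * P = Q * X * P + Q * Y * P"
  using assms
  by (simp add: carrier mult_add_distrib_mat[of _ n n _ n] add_mult_distrib_mat[of _ n n _ _ n])

lemma conjugate_minus:
  assumes "X \<in> carrier_mat n n" "Y \<in> carrier_mat n n"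
  shows "Q * (X - Y) * P = Q * X * P - Q * Y * P"
  using assms
  by (simp add: carrier mult_minus_distrib_mat[of _ n n _ n] minus_mult_distrib_mat[of _ n n _ _ n])

lemma conjugate_smult:
  assumes "X \<in> carrier_mat n n"
  shows "Q * (k \<cdot>\<^sub>m X) * P = k \<cdot>\<^sub>m (Q * X * P)"
  using assms by (simp add: carrier mult_smult_distrib[of _ n n _ n] mult_smult_assoc_mat[of _ n n _ n])

lemma conjugate_one: "Q * 1\<^sub>m n * P = 1\<^sub>m n"
  using PQ by (simp add: basis_change_def right_mult_one_mat[of _ n n])

end

lemma similar_mat_iff_basis_change:
  assumes M: "M \<in> carrier_mat n n"
  shows "similar_mat M D \<longleftrightarrow> (\<exists>P Q. basis_change n P Q \<and> Q * M * P = D)"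
proof
  assume "similar_mat M D"
  then obtain P Q where wit: "similar_mat_wit M D P Q"
    unfolding similar_mat_def by blast
  have "basis_change n P Q"
    unfolding basis_change_def using similar_mat_witD2[OF M wit] by (intro conjI)
  moreover have "Q * M * P = D"
    using similar_mat_witD(3)[OF refl similar_mat_wit_sym[OF wit]] by simp
  ultimately show "\<exists>P Q. basis_change n P Q \<and> Q * M * P = D"
    by (intro exI conjI)
next
  assume "\<exists>P Q. basis_change n P Q \<and> Q * M * P = D"
  then obtain P Q where PQ: "basis_change n P Q" "D = Q * M * P" by (elim exE conjE) simp
  from conjugate_carrier[OF PQ(1) M] PQ M show "similar_mat M D"
    by (intro similar_mat_sym[OF similar_matI[of D M Q P n]])
      (simp_all only: basis_change_def insert_subset empty_subsetI)
qed

lemma similar_mat_of_intertwiner: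
  fixes M :: "'a :: field mat"
  assumes M: "M \<in> carrier_mat n n" and L: "L \<in> carrier_mat n n" and P: "P \<in> carrier_mat n n"
    and det: "det P \<noteq> 0" and eq: "M * P = P * L"
  shows "similar_mat M L"
proof -
  from det_non_zero_imp_unit[OF P det, of "()"]
  obtain Q where Q: "Q \<in> carrier_mat n n" "P * Q = 1\<^sub>m n" "Q * P = 1\<^sub>m n"
    by (auto simp: Units_def ring_mat_simps)
  have "M = M * (P * Q)" using M Q by simp
  also have "\<dots> = P * L * Q" using M P Q(1) eq by (simp flip: assoc_mult_mat)
  finally show ?thesis
    by (intro similar_matI[OF _ Q(2,3)]) (use M L P Q in auto)
qed

lemma similar_mat_transpose:
  fixes M L :: "'a :: comm_semiring_1 mat"
  assumes "similar_mat M L"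
  shows "similar_mat M\<^sup>T L\<^sup>T"
proof -
  from similar_matD[OF assms] obtain n P Q
    where car: "{M, L, P, Q} \<subseteq> carrier_mat n n"
      and PQ: "P * Q = 1\<^sub>m n" "Q * P = 1\<^sub>m n" and M: "M = P * L * Q" by blast
  have tr: "(X * Y)\<^sup>T = Y\<^sup>T * X\<^sup>T" if "X \<in> carrier_mat n n" "Y \<in> carrier_mat n n" for X Y :: "'a mat"
    using that by (rule transpose_mult)
  show ?thesis
  proof (rule similar_matI)
    show "{M\<^sup>T, L\<^sup>T, Q\<^sup>T, P\<^sup>T} \<subseteq> carrier_mat n n" using car by simp
    show "Q\<^sup>T * P\<^sup>T = 1\<^sub>m n" using tr[of P Q] PQ(1) car by simp
    show "P\<^sup>T * Q\<^sup>T = 1\<^sub>m n" using tr[of Q P] PQ(2) car by simp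
    show "M\<^sup>T = Q\<^sup>T * L\<^sup>T * P\<^sup>T"
      using car by (simp add: M tr mult_carrier_mat[of _ n n] assoc_mult_mat[of _ n n _ n _ n])
  qed
qed

lemma diagonal_mat_eq_mat_diag:
  assumes D: "D \<in> carrier_mat n n" and diag: "diagonal_mat D"
  shows "D = mat_diag n (\<lambda>i. D $$ (i,i))"
proof (rule eq_matI)
  fix i j assume "i < dim_row (mat_diag n (\<lambda>i. D $$ (i,i)))" "j < dim_col (mat_diag n (\<lambda>i. D $$ (i,i)))"
  then show "D $$ (i,j) = mat_diag n (\<lambda>i. D $$ (i,i)) $$ (i,j)"
    using D diag by (auto simp: mat_diag_def diagonal_mat_def)
qed (use D in \<open>auto simp: mat_diag_def\<close>)

lemma diagonal_mat_diag: "diagonal_mat (mat_diag n t)"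
  by (simp add: diagonal_mat_def mat_diag_def)

lemma transpose_mat_diag: "(mat_diag n t)\<^sup>T = mat_diag n t"
  by (rule eq_matI) (auto simp: mat_diag_def)

lemma diagonalizable_iff_similar_mat_diag:
  assumes "M \<in> carrier_mat n n"
  shows "diagonalizable n M \<longleftrightarrow> (\<exists>t. similar_mat M (mat_diag n t))"
proof
  assume "diagonalizable n M"
  then obtain P Q where PQ: "basis_change n P Q" and diag: "diagonal_mat (Q * M * P)"
    unfolding diagonalizable_def by blast
  obtain t where "Q * M * P = mat_diag n t"
    using diagonal_mat_eq_mat_diag[OF conjugate_carrier[OF PQ assms] diag] by (rule that)
  with PQ show "\<exists>t. similar_mat M (mat_diag n t)"
    unfolding similar_mat_iff_basis_change[OF assms] by (intro exI conjI)
next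
  assume "\<exists>t. similar_mat M (mat_diag n t)"
  then obtain t P Q where PQ: "basis_change n P Q" and "Q * M * P = mat_diag n t"
    unfolding similar_mat_iff_basis_change[OF assms] by (elim exE conjE)
  then have "diagonal_mat (Q * M * P)" by (simp add: diagonal_mat_diag)
  with PQ show "diagonalizable n M"
    unfolding diagonalizable_def by blast
qed

lemma diagonalizable_transpose:
  assumes M: "M \<in> carrier_mat n n"
  shows "diagonalizable n M\<^sup>T \<longleftrightarrow> diagonalizable n M"
proof -
  have "similar_mat M\<^sup>T (mat_diag n t) \<longleftrightarrow> similar_mat M (mat_diag n t)" for t
    using similar_mat_transpose[of M "mat_diag n t"] similar_mat_transpose[of "M\<^sup>T" "mat_diag n t"]
    by (auto simp: transpose_mat_diag)
  then show ?thesis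
    using M by (simp add: diagonalizable_iff_similar_mat_diag)
qed

lemma diagonalizable_similar:
  assumes "similar_mat M L" "M \<in> carrier_mat n n" "L \<in> carrier_mat n n"
  shows "diagonalizable n M \<longleftrightarrow> diagonalizable n L"
  unfolding assms(2,3)[THEN diagonalizable_iff_similar_mat_diag]
  using similar_mat_trans[OF assms(1)] similar_mat_trans[OF similar_mat_sym[OF assms(1)]] by blast

section \<open>Bidiagonal matrices\<close>

definition lower_bidiag :: "nat \<Rightarrow> (nat \<Rightarrow> 'a) \<Rightarrow> (nat \<Rightarrow> 'a) \<Rightarrow> 'a :: zero mat" where
  "lower_bidiag n t u = mat n n (\<lambda>(i,j). if i = j then t i else if i = j + 1 then u i else 0)"

definition lower_bidiag_op :: "(nat \<Rightarrow> 'a) \<Rightarrow> (nat \<Rightarrow> 'a) \<Rightarrow> (nat \<Rightarrow> 'a) \<Rightarrow> nat \<Rightarrow> 'a :: semiring_0" where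
  "lower_bidiag_op t u f i = t i * f i + (if i = 0 then 0 else u i * f (i - 1))"

definition upper_bidiag_op :: "nat \<Rightarrow> (nat \<Rightarrow> 'a) \<Rightarrow> (nat \<Rightarrow> 'a) \<Rightarrow> (nat \<Rightarrow> 'a) \<Rightarrow> nat \<Rightarrow> 'a :: semiring_0" where
  "upper_bidiag_op n t u f i = t i * f i + (if Suc i < n then u (Suc i) * f (Suc i) else 0)"

lemma lower_bidiag_carrier [simp]: "lower_bidiag n t u \<in> carrier_mat n n"
  by (simp add: lower_bidiag_def)

lemma lower_bidiag_mult_vec:
  "lower_bidiag n t u *\<^sub>v vec n f = vec n (lower_bidiag_op t u f)"
proof (rule eq_vecI)
  fix i assume "i < dim_vec (vec n (lower_bidiag_op t u f))"
  then have i: "i < n" by simp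
  have "(lower_bidiag n t u *\<^sub>v vec n f) $ i
      = (\<Sum>j\<in>{0..<n}. (if j = i then t i * f i else 0) + (if i = j + 1 then u i * f j else 0))"
    using i by (auto simp: lower_bidiag_def scalar_prod_def intro!: sum.cong)
  also have "\<dots> = t i * f i + (\<Sum>j\<in>{0..<n}. if i = j + 1 then u i * f j else 0)"
    using i by (simp add: sum.distrib)
  also have "(\<Sum>j\<in>{0..<n}. if i = j + 1 then u i * f j else 0) = (if i = 0 then 0 else u i * f (i - 1))"
    using i by (cases i) auto
  finally show "(lower_bidiag n t u *\<^sub>v vec n f) $ i = vec n (lower_bidiag_op t u f) $ i"
    using i by (simp add: lower_bidiag_op_def)
qed (simp add: lower_bidiag_def)

lemma transpose_lower_bidiag_mult_vec:
  "(lower_bidiag n t u)\<^sup>T *\<^sub>v vec n f = vec n (upper_bidiag_op n t u f)"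
proof (rule eq_vecI)
  fix i assume "i < dim_vec (vec n (upper_bidiag_op n t u f))"
  then have i: "i < n" by simp
  have "((lower_bidiag n t u)\<^sup>T *\<^sub>v vec n f) $ i
      = (\<Sum>j\<in>{0..<n}. (if j = i then t i * f i else 0) + (if j = Suc i then u (Suc i) * f (Suc i) else 0))"
    using i by (auto simp: lower_bidiag_def scalar_prod_def intro!: sum.cong)
  also have "\<dots> = upper_bidiag_op n t u f i"
    using i by (simp add: sum.distrib upper_bidiag_op_def)
  finally show "((lower_bidiag n t u)\<^sup>T *\<^sub>v vec n f) $ i = vec n (upper_bidiag_op n t u f) $ i"
    using i by simp
qed (simp add: lower_bidiag_def)

lemma mult_lower_bidiag_index:
  fixes W :: "'a :: comm_semiring_0 mat"
  assumes "W \<in> carrier_mat m n" "k < m" "i < n"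
  shows "(W * lower_bidiag n t u) $$ (k,i) = upper_bidiag_op n t u (\<lambda>j. W $$ (k,j)) i"
proof -
  have "(W * lower_bidiag n t u) $$ (k,i) = ((lower_bidiag n t u)\<^sup>T *\<^sub>v row W k) $ i"
    using assms by (simp add: lower_bidiag_def scalar_prod_def mult.commute)
  also have "row W k = vec n (\<lambda>j. W $$ (k,j))"
    using assms by auto
  finally show ?thesis
    using assms by (simp add: transpose_lower_bidiag_mult_vec)
qed

lemma similar_lower_bidiag_of_chain:
  fixes M :: "'a :: field mat"
  assumes M: "M \<in> carrier_mat n n" and P: "P \<in> carrier_mat n n" and det: "det P \<noteq> 0"
    and chain: "\<And>i k. i < n \<Longrightarrow> k < n \<Longrightarrow>
      (M *\<^sub>v col P i) $ k = t i * P $$ (k,i) + (if Suc i < n then P $$ (k, Suc i) else 0)"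
  shows "similar_mat M (lower_bidiag n t (\<lambda>_. 1))"
proof (rule similar_mat_of_intertwiner[OF M lower_bidiag_carrier P det], rule eq_matI)
  fix k i assume "k < dim_row (P * lower_bidiag n t (\<lambda>_. 1))" "i < dim_col (P * lower_bidiag n t (\<lambda>_. 1))"
  then have ki: "k < n" "i < n" using P by (auto simp: lower_bidiag_def)
  then have "(M * P) $$ (k,i) = (M *\<^sub>v col P i) $ k" using M P by simp
  also have "\<dots> = (P * lower_bidiag n t (\<lambda>_. 1)) $$ (k,i)"
    by (simp add: mult_lower_bidiag_index[OF P ki] chain[OF ki(2,1)] upper_bidiag_op_def)
  finally show "(M * P) $$ (k,i) = (P * lower_bidiag n t (\<lambda>_. 1)) $$ (k,i)" .
qed (use M P in \<open>auto simp: lower_bidiag_def\<close>)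

definition lower_bidiag_eigenvector :: "(nat \<Rightarrow> 'a) \<Rightarrow> (nat \<Rightarrow> 'a) \<Rightarrow> nat \<Rightarrow> nat \<Rightarrow> 'a :: field" where
  "lower_bidiag_eigenvector t u j i = (if j \<le> i then \<Prod>h\<in>{j<..i}. u h / (t j - t h) else 0)"

lemma lower_bidiag_eigenvector:
  assumes inj: "inj_on t {..<n}" and ij: "i < n" "j < n"
  shows "lower_bidiag_op t u (lower_bidiag_eigenvector t u j) i = t j * lower_bidiag_eigenvector t u j i"
proof (cases i)
  case 0
  then show ?thesis by (simp add: lower_bidiag_op_def lower_bidiag_eigenvector_def)
next
  case (Suc m)
  consider (diagonal) "j = i" | (below) "j < i" | (above) "i < j" by linarith
  then show ?thesis
  proof cases
    case below
    then have "t j \<noteq> t i" using inj_onD[OF inj, of j i] ij by auto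
    moreover have "{j<..i} = insert i {j<..m}" using below Suc by auto
    then have "lower_bidiag_eigenvector t u j i = u i / (t j - t i) * lower_bidiag_eigenvector t u j m"
      using below Suc by (simp add: lower_bidiag_eigenvector_def)
    ultimately show ?thesis
      using Suc by (simp add: lower_bidiag_op_def field_simps)
  qed (auto simp: lower_bidiag_op_def lower_bidiag_eigenvector_def Suc)
qed

lemma lower_bidiag_similar_mat_diag:
  fixes t :: "nat \<Rightarrow> 'a :: field"
  assumes inj: "inj_on t {..<n}"
  shows "similar_mat (lower_bidiag n t u) (mat_diag n t)"
proof -
  define P where "P = mat n n (\<lambda>(i,j). lower_bidiag_eigenvector t u j i)"
  have P: "P \<in> carrier_mat n n" by (simp add: P_def)
  have "det P = prod_list (diag_mat P)"
    by (rule det_lower_triangular[OF _ P]) (auto simp: P_def lower_bidiag_eigenvector_def)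
  also have "diag_mat P = map (\<lambda>_. 1) [0..<n]"
    by (auto simp: diag_mat_def P_def lower_bidiag_eigenvector_def)
  finally have "det P \<noteq> 0" by auto
  moreover have "lower_bidiag n t u * P = P * mat_diag n t"
  proof (rule eq_matI)
    fix i j assume "i < dim_row (P * mat_diag n t)" "j < dim_col (P * mat_diag n t)"
    then have ij: "i < n" "j < n" by (auto simp: P_def mat_diag_def)
    have "(lower_bidiag n t u * P) $$ (i,j) = (lower_bidiag n t u *\<^sub>v col P j) $ i"
      using ij P by (simp add: lower_bidiag_def)
    also have "col P j = vec n (lower_bidiag_eigenvector t u j)"
      using ij by (auto simp: P_def)
    also have "(lower_bidiag n t u *\<^sub>v vec n (lower_bidiag_eigenvector t u j)) $ i
        = t j * lower_bidiag_eigenvector t u j i"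
      using ij by (simp add: lower_bidiag_mult_vec lower_bidiag_eigenvector[OF inj])
    also have "\<dots> = (P * mat_diag n t) $$ (i,j)"
      using ij by (simp add: mat_diag_mult_right[OF P]) (simp add: P_def)
    finally show "(lower_bidiag n t u * P) $$ (i,j) = (P * mat_diag n t) $$ (i,j)" .
  qed (auto simp: P_def lower_bidiag_def mat_diag_def)
  ultimately show ?thesis
    by (intro similar_mat_of_intertwiner[OF _ _ P]) auto
qed

lemma lower_bidiag_op_eigenfunction_eq_0:
  fixes t :: "nat \<Rightarrow> 'a :: idom"
  assumes eig: "\<And>i. i < n \<Longrightarrow> lower_bidiag_op t u f i = \<mu> * f i" and "\<mu> \<notin> t ` {..<n}" and "i < n"
  shows "f i = 0"
  using \<open>i < n\<close>
proof (induction i)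
  case 0
  then show ?case using eig[of 0] assms(2) by (auto simp: lower_bidiag_op_def)
next
  case (Suc i)
  then have "t (Suc i) * f (Suc i) = \<mu> * f (Suc i)"
    using eig[of "Suc i"] by (simp add: lower_bidiag_op_def)
  moreover have "\<mu> \<noteq> t (Suc i)" using assms(2) Suc.prems by auto
  ultimately show ?case by simp
qed

lemma lower_bidiag_op_eigenfunction_eq_0_if_last:
  fixes t :: "nat \<Rightarrow> 'a :: idom"
  assumes eig: "\<And>i. i < n \<Longrightarrow> lower_bidiag_op t u f i = \<mu> * f i"
    and u: "\<forall>i\<in>{0<..<n}. u i \<noteq> 0" and last: "f (n - 1) = 0" and "i < n"
  shows "f i = 0"
proof -
  have "i \<le> n - 1" using \<open>i < n\<close> by simp
  then show ?thesis
  proof (induction rule: inc_induct)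
    case base
    show ?case by (rule last)
  next
    case (step m)
    then show ?case using eig[of "Suc m"] u by (simp add: lower_bidiag_op_def)
  qed
qed

lemma lower_bidiag_eigenvector_last:
  fixes t :: "nat \<Rightarrow> 'a :: idom"
  assumes u: "\<forall>i\<in>{0<..<n}. u i \<noteq> 0"
    and v: "v \<in> carrier_vec n" "v \<noteq> 0\<^sub>v n" and eig: "lower_bidiag n t u *\<^sub>v v = \<mu> \<cdot>\<^sub>v v"
  shows "\<mu> \<in> t ` {..<n}" "v $ (n - 1) \<noteq> 0"
proof -
  define f where "f = vec_index v"
  have vf: "v = vec n f" using v(1) by (auto simp: f_def)
  then have op: "vec n (lower_bidiag_op t u f) = \<mu> \<cdot>\<^sub>v vec n f"
    using eig by (simp add: lower_bidiag_mult_vec)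
  have f: "lower_bidiag_op t u f i = \<mu> * f i" if "i < n" for i
    using arg_cong[OF op, of "\<lambda>w. w $ i"] that by simp
  have "\<exists>i<n. f i \<noteq> 0" using v(2) unfolding vf by auto
  then show "\<mu> \<in> t ` {..<n}" "v $ (n - 1) \<noteq> 0"
    using lower_bidiag_op_eigenfunction_eq_0[OF f] lower_bidiag_op_eigenfunction_eq_0_if_last[OF f u]
    by (auto simp: f_def)
qed

lemma lower_bidiag_eigencoordinates_last:
  fixes t :: "nat \<Rightarrow> complex"
  assumes u: "\<forall>i\<in>{0<..<n}. u i \<noteq> 0"
    and PQ: "basis_change n P Q" and diag: "Q * lower_bidiag n t u * P = mat_diag n e"
    and w: "w \<in> carrier_vec n" "w \<noteq> 0\<^sub>v n" and ew: "\<And>i. i < n \<Longrightarrow> e i * w $ i = \<mu> * w $ i"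
  shows "\<mu> \<in> t ` {..<n}" "(P *\<^sub>v w) $ (n - 1) \<noteq> 0"
proof -
  note P = basis_change_carrier(1)[OF PQ]
  have "mat_diag n e *\<^sub>v w = \<mu> \<cdot>\<^sub>v w"
    using w(1) ew by (intro eq_vecI) (simp_all add: mat_diag_mult_vec)
  then have eig: "lower_bidiag n t u *\<^sub>v (P *\<^sub>v w) = \<mu> \<cdot>\<^sub>v (P *\<^sub>v w)"
    using conjugate_mult_vec[OF PQ lower_bidiag_carrier w(1), of t u] w(1)
    by (simp add: diag mult_mat_vec[OF P])
  have "P *\<^sub>v w \<noteq> 0\<^sub>v n" using basis_change_mult_vec_eq_0[OF PQ w(1)] w(2) by blast
  from lower_bidiag_eigenvector_last[OF u mult_mat_vec_carrier[OF P w(1)] this eig]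
  show "\<mu> \<in> t ` {..<n}" "(P *\<^sub>v w) $ (n - 1) \<noteq> 0" by simp_all
qed

lemma lower_bidiag_similar_mat_diag_imp_inj_on:
  fixes t :: "nat \<Rightarrow> complex"
  assumes u: "\<forall>i\<in>{0<..<n}. u i \<noteq> 0"
    and sim: "similar_mat (lower_bidiag n t u) (mat_diag n e)"
  shows "inj_on t {..<n}"
proof -
  obtain P Q where PQ: "basis_change n P Q" and diag: "Q * lower_bidiag n t u * P = mat_diag n e"
    using sim unfolding similar_mat_iff_basis_change[OF lower_bidiag_carrier] by (elim exE conjE)
  note P = basis_change_carrier(1)[OF PQ]
  note eigen = lower_bidiag_eigencoordinates_last[OF u PQ diag]
  have column: "e j \<in> t ` {..<n}" "P $$ (n - 1, j) \<noteq> 0" if "j < n" for j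
    using eigen[of "unit_vec n j" "e j"] that P by (auto simp: mult_mat_unit_vec)
  have "inj_on e {..<n}"
  proof (rule inj_onI, rule ccontr)
    fix j k assume jk: "j \<in> {..<n}" "k \<in> {..<n}" "e j = e k" "j \<noteq> k"
    define w where "w = P $$ (n - 1, k) \<cdot>\<^sub>v unit_vec n j - P $$ (n - 1, j) \<cdot>\<^sub>v unit_vec n k"
    have w: "w \<in> carrier_vec n" by (simp add: w_def)
    have "w $ j \<noteq> 0" using jk column(2)[of k] by (simp add: w_def)
    then have "w \<noteq> 0\<^sub>v n" using jk by auto
    moreover have "e i * w $ i = e j * w $ i" if "i < n" for i
      using jk that by (auto simp: w_def)
    ultimately have "(P *\<^sub>v w) $ (n - 1) \<noteq> 0" by (rule eigen(2)[OF w])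
    moreover have "P *\<^sub>v w = P $$ (n - 1, k) \<cdot>\<^sub>v col P j - P $$ (n - 1, j) \<cdot>\<^sub>v col P k"
      unfolding w_def using jk P
      by (subst mult_minus_distrib_mat_vec[OF P]) (auto simp: mult_mat_unit_vec mult_mat_vec[OF P])
    then have "(P *\<^sub>v w) $ (n - 1) = 0" using jk P by simp
    ultimately show False by simp
  qed
  then have "n = card (e ` {..<n})" by (simp add: card_image)
  also have "\<dots> \<le> card (t ` {..<n})" using column(1) by (intro card_mono) auto
  finally have "card (t ` {..<n}) = card {..<n}"
    using card_image_le[of "{..<n}" t] by simp
  then show ?thesis by (intro eq_card_imp_inj_on) auto
qed

lemma diagonalizable_lower_bidiag_iff:
  fixes t :: "nat \<Rightarrow> complex"
  assumes "\<forall>i\<in>{0<..<n}. u i \<noteq> 0"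
  shows "diagonalizable n (lower_bidiag n t u) \<longleftrightarrow> inj_on t {..<n}"
proof
  assume "diagonalizable n (lower_bidiag n t u)"
  then obtain e where "similar_mat (lower_bidiag n t u) (mat_diag n e)"
    unfolding diagonalizable_iff_similar_mat_diag[OF lower_bidiag_carrier] ..
  with assms show "inj_on t {..<n}" by (rule lower_bidiag_similar_mat_diag_imp_inj_on)
next
  assume "inj_on t {..<n}"
  then show "diagonalizable n (lower_bidiag n t u)"
    unfolding diagonalizable_iff_similar_mat_diag[OF lower_bidiag_carrier]
    by (intro exI[of _ t] lower_bidiag_similar_mat_diag)
qed

section \<open>Irreducible pairs of matrices\<close>

definition irreducible_pair :: "nat \<Rightarrow> complex mat \<Rightarrow> complex mat \<Rightarrow> bool" where
  "irreducible_pair n M N \<longleftrightarrow>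
     (\<forall>W. is_subspace n W \<and> invariant_under M W \<and> invariant_under N W
        \<longrightarrow> W = {0\<^sub>v n} \<or> W = carrier_vec n)"

lemma irreducible_pair_commute: "irreducible_pair n M N \<Longrightarrow> irreducible_pair n N M"
  unfolding irreducible_pair_def by blast

definition vanishing_subspace :: "nat \<Rightarrow> complex mat \<Rightarrow> nat set \<Rightarrow> complex vec set" where
  "vanishing_subspace n Q S = {v \<in> carrier_vec n. \<forall>k\<in>S. (Q *\<^sub>v v) $ k = 0}"

lemma is_subspace_vanishing_subspace:
  assumes Q: "Q \<in> carrier_mat n n" and S: "S \<subseteq> {..<n}"
  shows "is_subspace n (vanishing_subspace n Q S)"
  unfolding is_subspace_def
proof (intro conjI ballI allI)
  fix u v k assume uv: "u \<in> vanishing_subspace n Q S" "v \<in> vanishing_subspace n Q S"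
  then have car: "u \<in> carrier_vec n" "v \<in> carrier_vec n" by (simp_all add: vanishing_subspace_def)
  show "u + v \<in> vanishing_subspace n Q S"
    using uv car Q S
    by (auto simp: vanishing_subspace_def mult_add_distrib_mat_vec[OF Q car] subset_iff
        simp del: index_mult_mat_vec)
  show "k \<cdot>\<^sub>v u \<in> vanishing_subspace n Q S"
    using uv car Q S
    by (auto simp: vanishing_subspace_def mult_mat_vec[OF Q] subset_iff simp del: index_mult_mat_vec)
qed (use Q S in \<open>auto simp: vanishing_subspace_def\<close>)

lemma invariant_under_vanishing_subspace:
  assumes PQ: "basis_change n P Q" and L: "L \<in> carrier_mat n n" and S: "S \<subseteq> {..<n}"
    and block: "\<And>k l. k \<in> S \<Longrightarrow> l < n \<Longrightarrow> l \<notin> S \<Longrightarrow> (Q * L * P) $$ (k,l) = 0"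
  shows "invariant_under L (vanishing_subspace n Q S)"
  unfolding invariant_under_def
proof
  fix v assume "v \<in> vanishing_subspace n Q S"
  then have v: "v \<in> carrier_vec n" and v0: "\<And>k. k \<in> S \<Longrightarrow> (Q *\<^sub>v v) $ k = 0"
    by (simp_all add: vanishing_subspace_def)
  note Q = basis_change_carrier(2)[OF PQ]
  have Qv: "Q *\<^sub>v v \<in> carrier_vec n" using mult_mat_vec_carrier[OF Q v] .
  have QLP: "Q * L * P \<in> carrier_mat n n" by (rule conjugate_carrier[OF PQ L])
  have "P *\<^sub>v ((Q * L * P) *\<^sub>v (Q *\<^sub>v v)) = L *\<^sub>v v"
    using conjugate_mult_vec[OF PQ L Qv] basis_change_cancel(2)[OF PQ v] by simp
  then have QLv: "Q *\<^sub>v (L *\<^sub>v v) = (Q * L * P) *\<^sub>v (Q *\<^sub>v v)"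
    using basis_change_cancel(1)[OF PQ mult_mat_vec_carrier[OF QLP Qv]] by simp
  have "(Q *\<^sub>v (L *\<^sub>v v)) $ k = 0" if k: "k \<in> S" for k
  proof -
    have "(Q *\<^sub>v (L *\<^sub>v v)) $ k = (\<Sum>l\<in>{0..<n}. (Q * L * P) $$ (k,l) * (Q *\<^sub>v v) $ l)"
      unfolding QLv using S k by (intro mult_mat_vec_index[OF QLP Qv]) auto
    also have "\<dots> = 0"
      using block[OF k] v0 by (intro sum.neutral) force
    finally show ?thesis .
  qed
  then show "L *\<^sub>v v \<in> vanishing_subspace n Q S"
    using L v by (simp add: vanishing_subspace_def)
qed

lemma vanishing_subspace_proper:
  assumes PQ: "basis_change n P Q" and S: "S \<subset> {..<n}" "S \<noteq> {}"
  shows "vanishing_subspace n Q S \<noteq> {0\<^sub>v n}" "vanishing_subspace n Q S \<noteq> carrier_vec n"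
proof -
  note P = basis_change_carrier(1)[OF PQ]
  have coord: "Q *\<^sub>v (P *\<^sub>v unit_vec n l) = unit_vec n l" for l
    by (rule basis_change_cancel(1)[OF PQ unit_vec_carrier])
  have car: "P *\<^sub>v unit_vec n l \<in> carrier_vec n" for l
    by (rule mult_mat_vec_carrier[OF P unit_vec_carrier])
  from S obtain l where l: "l < n" "l \<notin> S" by auto
  then have "unit_vec n l $ k = (0 :: complex)" if "k \<in> S" for k
    using S that by (subst index_unit_vec) auto
  then have "P *\<^sub>v unit_vec n l \<in> vanishing_subspace n Q S"
    using car by (simp add: vanishing_subspace_def coord)
  moreover have "P *\<^sub>v unit_vec n l \<noteq> 0\<^sub>v n"
    using basis_change_mult_vec_eq_0[OF PQ unit_vec_carrier] unit_vec_nonzero[OF l(1)] by blast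
  ultimately show "vanishing_subspace n Q S \<noteq> {0\<^sub>v n}" by blast
  from S obtain k where "k < n" "k \<in> S" by auto
  then have "P *\<^sub>v unit_vec n k \<notin> vanishing_subspace n Q S"
    by (auto simp: vanishing_subspace_def coord intro!: bexI[of _ k])
  then show "vanishing_subspace n Q S \<noteq> carrier_vec n" using car by blast
qed

lemma irreducible_pair_off_block_nonzero:
  assumes irr: "irreducible_pair n M N" and M: "M \<in> carrier_mat n n" and N: "N \<in> carrier_mat n n"
    and PQ: "basis_change n P Q" and S: "S \<subset> {..<n}" "S \<noteq> {}"
  shows "\<exists>k\<in>S. \<exists>l\<in>{..<n} - S. (Q * M * P) $$ (k,l) \<noteq> 0 \<or> (Q * N * P) $$ (k,l) \<noteq> 0"
proof (rule ccontr)
  assume "\<not> ?thesis"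
  then have "(Q * M * P) $$ (k,l) = 0" "(Q * N * P) $$ (k,l) = 0" if "k \<in> S" "l < n" "l \<notin> S" for k l
    using that by blast+
  then have "invariant_under M (vanishing_subspace n Q S)" "invariant_under N (vanishing_subspace n Q S)"
    using S(1)
    by (auto intro!: invariant_under_vanishing_subspace[OF PQ M] invariant_under_vanishing_subspace[OF PQ N])
  moreover have "is_subspace n (vanishing_subspace n Q S)"
    using S(1) by (intro is_subspace_vanishing_subspace[OF basis_change_carrier(2)[OF PQ]]) auto
  ultimately show False
    using irr vanishing_subspace_proper[OF PQ S] unfolding irreducible_pair_def by blast
qed

lemma invariant_under_complement:
  assumes W: "is_subspace n W" and car: "M \<in> carrier_mat n n" "N \<in> carrier_mat n n" "K \<in> carrier_mat n n"
    and sum: "M + N + K = s \<cdot>\<^sub>m 1\<^sub>m n" and inv: "invariant_under M W" "invariant_under N W"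
  shows "invariant_under K W"
  unfolding invariant_under_def
proof
  fix v assume v: "v \<in> W"
  then have v_carrier: "v \<in> carrier_vec n" using W by (auto simp: is_subspace_def)
  have "M *\<^sub>v v + N *\<^sub>v v + K *\<^sub>v v = (M + N + K) *\<^sub>v v"
    using car v_carrier by (simp flip: add_mult_distrib_mat_vec[of _ n n])
  also have "\<dots> = s \<cdot>\<^sub>v v"
    unfolding sum using v_carrier by auto
  finally have sum_v: "M *\<^sub>v v + N *\<^sub>v v + K *\<^sub>v v = s \<cdot>\<^sub>v v" .
  have "K *\<^sub>v v = s \<cdot>\<^sub>v v + (-1) \<cdot>\<^sub>v (M *\<^sub>v v + N *\<^sub>v v)"
    unfolding sum_v[symmetric] using car by (intro eq_vecI) (auto simp del: index_mult_mat_vec)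
  then show "K *\<^sub>v v \<in> W"
    using W inv v unfolding is_subspace_def invariant_under_def by metis
qed

lemma irreducible_pair_complement:
  assumes irr: "irreducible_pair n M N"
    and car: "M \<in> carrier_mat n n" "N \<in> carrier_mat n n" "K \<in> carrier_mat n n"
    and sum: "K + M + N = s \<cdot>\<^sub>m 1\<^sub>m n"
  shows "irreducible_pair n K M"
  using irr invariant_under_complement[OF _ car(3,1,2) sum] unfolding irreducible_pair_def by blast

lemma invariant_under_commutator:
  assumes W: "is_subspace n W" and car: "M \<in> carrier_mat n n" "N \<in> carrier_mat n n"
    and inv: "invariant_under M W" "invariant_under N W"
  shows "invariant_under (k \<cdot>\<^sub>m (M * N - N * M)) W"
  unfolding invariant_under_def
proof
  fix v assume v: "v \<in> W"
  then have v_carrier: "v \<in> carrier_vec n" using W by (auto simp: is_subspace_def)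
  have MN: "M * N \<in> carrier_mat n n" "N * M \<in> carrier_mat n n" using car by auto
  have "(k \<cdot>\<^sub>m (M * N - N * M)) *\<^sub>v v = k \<cdot>\<^sub>v ((M * N) *\<^sub>v v - (N * M) *\<^sub>v v)"
    using MN v_carrier
    by (simp add: smult_mat_mult_vec[of _ n n] minus_mult_distrib_mat_vec[of _ n n] minus_carrier_mat)
  also have "\<dots> = k \<cdot>\<^sub>v (M *\<^sub>v (N *\<^sub>v v) + (-1) \<cdot>\<^sub>v (N *\<^sub>v (M *\<^sub>v v)))"
    using car v_carrier by (intro eq_vecI) (auto simp del: index_mult_mat_vec)
  finally have "(k \<cdot>\<^sub>m (M * N - N * M)) *\<^sub>v v = k \<cdot>\<^sub>v (M *\<^sub>v (N *\<^sub>v v) + (-1) \<cdot>\<^sub>v (N *\<^sub>v (M *\<^sub>v v)))" .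
  then show "(k \<cdot>\<^sub>m (M * N - N * M)) *\<^sub>v v \<in> W"
    using W inv v unfolding is_subspace_def invariant_under_def by metis
qed

section \<open>Tridiagonal matrices\<close>

lemma diagonal_mat_index:
  "D \<in> carrier_mat n n \<Longrightarrow> diagonal_mat D \<Longrightarrow> i < n \<Longrightarrow> j < n \<Longrightarrow> i \<noteq> j \<Longrightarrow> D $$ (i,j) = 0"
  by (simp add: diagonal_mat_def)

lemma tridiagonal_iff:
  "T \<in> carrier_mat n n \<Longrightarrow>
    tridiagonal T \<longleftrightarrow> (\<forall>i<n. \<forall>j<n. T $$ (i,j) \<noteq> 0 \<longrightarrow> i \<le> j + 1 \<and> j \<le> i + 1)"
  by (simp add: tridiagonal_def)

lemma irred_tridiagonal_iff:
  "T \<in> carrier_mat n n \<Longrightarrow>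
    irred_tridiagonal T \<longleftrightarrow>
      tridiagonal T \<and> (\<forall>i. i + 1 < n \<longrightarrow> T $$ (i+1, i) \<noteq> 0 \<and> T $$ (i, i+1) \<noteq> 0)"
  by (simp add: irred_tridiagonal_def)

lemma irred_tridiagonal_of_irreducible_pair:
  assumes irr: "irreducible_pair n M N" and M: "M \<in> carrier_mat n n" and N: "N \<in> carrier_mat n n"
    and PQ: "basis_change n P Q" and diag: "diagonal_mat (Q * M * P)" and tri: "tridiagonal (Q * N * P)"
  shows "irred_tridiagonal (Q * N * P)"
proof -
  define T where "T = Q * N * P"
  have T: "T \<in> carrier_mat n n" unfolding T_def by (rule conjugate_carrier[OF PQ N])
  have band: "k \<le> l + 1 \<and> l \<le> k + 1" if "k < n" "l < n" "T $$ (k,l) \<noteq> 0" for k l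
    using tri that unfolding T_def[symmetric] tridiagonal_iff[OF T] by blast
  have cut: "\<exists>k\<in>S. \<exists>l\<in>{..<n} - S. T $$ (k,l) \<noteq> 0" if S: "S \<subset> {..<n}" "S \<noteq> {}" for S
  proof -
    from irreducible_pair_off_block_nonzero[OF irr M N PQ S] obtain k l where kl: "k \<in> S" "l \<in> {..<n} - S"
      and nz: "(Q * M * P) $$ (k,l) \<noteq> 0 \<or> T $$ (k,l) \<noteq> 0"
      unfolding T_def by (elim bexE)
    have "k < n" "l < n" "k \<noteq> l" using kl S by auto
    with diagonal_mat_index[OF conjugate_carrier[OF PQ M] diag] nz have "T $$ (k,l) \<noteq> 0"
      by simp
    with kl show ?thesis by blast
  qed
  have "T $$ (i + 1, i) \<noteq> 0" "T $$ (i, i + 1) \<noteq> 0" if i: "i + 1 < n" for i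
  proof -
    have "{i<..<n} \<subseteq> {..<n}" "i \<in> {..<n} - {i<..<n}" "i + 1 \<in> {i<..<n}"
      "{..i} \<subseteq> {..<n}" "i + 1 \<in> {..<n} - {..i}" "i \<in> {..i}"
      using i by auto
    then have proper: "{i<..<n} \<subset> {..<n}" "{i<..<n} \<noteq> {}" "{..i} \<subset> {..<n}" "{..i} \<noteq> {}"
      by blast+
    from cut[OF proper(1,2)] obtain k l
      where "k \<in> {i<..<n}" "l \<in> {..<n} - {i<..<n}" and kl: "T $$ (k,l) \<noteq> 0" by blast
    with band[of k l] have "k = i + 1" "l = i" by auto
    with kl show "T $$ (i + 1, i) \<noteq> 0" by simp
    from cut[OF proper(3,4)] obtain k l
      where "k \<in> {..i}" "l \<in> {..<n} - {..i}" and kl: "T $$ (k,l) \<noteq> 0" by blast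
    with band[of k l] i have "k = i" "l = i + 1" by auto
    with kl show "T $$ (i, i + 1) \<noteq> 0" by simp
  qed
  then show ?thesis
    using tri unfolding T_def[symmetric] irred_tridiagonal_iff[OF T] by blast
qed

lemma irred_tridiagonal_complement:
  assumes M: "M \<in> carrier_mat n n" and N: "N \<in> carrier_mat n n" and K: "K \<in> carrier_mat n n"
    and sum: "M + N + K = s \<cdot>\<^sub>m 1\<^sub>m n" and diag: "diagonal_mat M" and tri: "irred_tridiagonal N"
  shows "irred_tridiagonal K"
proof -
  have off: "K $$ (i,j) = - N $$ (i,j)" if "i < n" "j < n" "i \<noteq> j" for i j
  proof -
    have "(M + N + K) $$ (i,j) = 0" unfolding sum using that by simp
    then show ?thesis
      using that M N K by (simp add: diagonal_mat_index[OF M diag] add_eq_0_iff2)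
  qed
  have "i \<le> j + 1 \<and> j \<le> i + 1" if "i < n" "j < n" "K $$ (i,j) \<noteq> 0" for i j
    using tri that off[of i j] unfolding irred_tridiagonal_iff[OF N] tridiagonal_iff[OF N]
    by (cases "i = j") auto
  moreover have "K $$ (i+1, i) \<noteq> 0" "K $$ (i, i+1) \<noteq> 0" if "i + 1 < n" for i
    using tri that off[of "i+1" i] off[of i "i+1"] unfolding irred_tridiagonal_iff[OF N] by auto
  ultimately show ?thesis
    unfolding irred_tridiagonal_iff[OF K] tridiagonal_iff[OF K] by blast
qed

section \<open>The Racah relation\<close>

text \<open>With Delta = [A,B]/2 and C = delta - A - B, the defining relation [A,Delta] + AC - BA = alpha
  reads [A,[A,B]] = 2(AB + BA + A^2 - delta A + alpha).\<close>

definition racah_relation :: "nat \<Rightarrow> 'a :: comm_ring_1 mat \<Rightarrow> 'a mat \<Rightarrow> 'a \<Rightarrow> 'a \<Rightarrow> bool" where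
  "racah_relation n M N r s \<longleftrightarrow>
     M * (M * N) + N * (M * M) - 2 \<cdot>\<^sub>m (M * (N * M))
       = 2 \<cdot>\<^sub>m (M * N + N * M + M * M - r \<cdot>\<^sub>m M + s \<cdot>\<^sub>m 1\<^sub>m n)"

lemma racah_relation_iff_index:
  assumes "M \<in> carrier_mat n n" "N \<in> carrier_mat n n"
  shows "racah_relation n M N r s \<longleftrightarrow> (\<forall>i<n. \<forall>j<n.
    (M * (M * N)) $$ (i,j) + (N * (M * M)) $$ (i,j) - 2 * (M * (N * M)) $$ (i,j)
      = 2 * ((M * N) $$ (i,j) + (N * M) $$ (i,j) + (M * M) $$ (i,j) - r * M $$ (i,j)
          + s * 1\<^sub>m n $$ (i,j)))" (is "_ \<longleftrightarrow> (\<forall>i<n. \<forall>j<n. ?lhs i j = ?rhs i j)")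
proof -
  let ?L = "M * (M * N) + N * (M * M) - 2 \<cdot>\<^sub>m (M * (N * M))"
  let ?R = "2 \<cdot>\<^sub>m (M * N + N * M + M * M - r \<cdot>\<^sub>m M + s \<cdot>\<^sub>m 1\<^sub>m n)"
  have index: "?L $$ (i,j) = ?lhs i j" "?R $$ (i,j) = ?rhs i j" if "i < n" "j < n" for i j
    using that assms by (simp_all del: index_mult_mat(1))
  have dim: "?L \<in> carrier_mat n n" "?R \<in> carrier_mat n n"
    by (rule carrier_matI; use assms in simp)+
  have "?L = ?R \<longleftrightarrow> (\<forall>i<n. \<forall>j<n. ?L $$ (i,j) = ?R $$ (i,j))"
    using dim by (metis carrier_matD eq_matI)
  then show ?thesis
    unfolding racah_relation_def using index by simp
qed

lemma racah_relation_conjugate: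
  assumes "basis_change n P Q" "M \<in> carrier_mat n n" "N \<in> carrier_mat n n" "racah_relation n M N r s"
  shows "racah_relation n (Q * M * P) (Q * N * P) r s"
proof -
  note conj = conjugate_mult[OF assms(1)] conjugate_add[OF assms(1)] conjugate_minus[OF assms(1)]
    conjugate_smult[OF assms(1)] conjugate_one[OF assms(1)]
  have "Q * (M * (M * N) + N * (M * M) - 2 \<cdot>\<^sub>m (M * (N * M))) * P
      = Q * (2 \<cdot>\<^sub>m (M * N + N * M + M * M - r \<cdot>\<^sub>m M + s \<cdot>\<^sub>m 1\<^sub>m n)) * P"
    using assms(4) unfolding racah_relation_def by simp
  then show ?thesis
    unfolding racah_relation_def
    by (simp add: conj assms(2,3) mult_carrier_mat[of _ n n _ n] minus_carrier_mat)
qed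

lemma racah_relation_transpose:
  assumes M: "M \<in> carrier_mat n n" and N: "N \<in> carrier_mat n n" and rel: "racah_relation n M N r s"
  shows "racah_relation n M\<^sup>T N\<^sup>T r s"
proof -
  note [simp] = mult_carrier_mat[of _ n n _ n] assoc_mult_mat[of _ n n _ n _ n]
  have mult: "X\<^sup>T * Y\<^sup>T = (Y * X)\<^sup>T" if "X \<in> carrier_mat n n" "Y \<in> carrier_mat n n" for X Y :: "'a mat"
    using that by (simp add: transpose_mult[of _ n n _ n])
  show ?thesis
    using rel M N unfolding racah_relation_iff_index[OF M N]
    by (simp add: racah_relation_iff_index mult add.commute eq_commute del: index_mult_mat(1))
qed

lemma tridiagonal_of_racah_relation:
  fixes t :: "nat \<Rightarrow> complex"
  assumes N: "N \<in> carrier_mat n n" and rel: "racah_relation n (mat_diag n t) N r s"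
    and adj: "\<And>i j. i < n \<Longrightarrow> j < n \<Longrightarrow> (t i - t j)^2 = 2 * (t i + t j) \<Longrightarrow> i \<le> j + 1"
  shows "tridiagonal N"
proof -
  have "i \<le> j + 1 \<and> j \<le> i + 1" if ij: "i < n" "j < n" and nz: "N $$ (i,j) \<noteq> 0" for i j
  proof (cases "i = j")
    case False
    have mult: "(mat_diag n e * X) $$ (i,j) = e i * X $$ (i,j)" "(X * mat_diag n e) $$ (i,j) = X $$ (i,j) * e j"
      if "X \<in> carrier_mat n n" for X e
      using ij that by (simp_all add: mat_diag_mult_left[of _ n n] mat_diag_mult_right[of _ n n])
    have "mat_diag n e $$ (i,j) = 0" "1\<^sub>m n $$ (i,j) = (0 :: complex)" for e :: "nat \<Rightarrow> complex"
      using ij False by (simp_all add: mat_diag_def)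
    then have "t i * (t i * N $$ (i,j)) + N $$ (i,j) * (t j * t j) - 2 * (t i * (N $$ (i,j) * t j))
        = 2 * (t i * N $$ (i,j) + N $$ (i,j) * t j)"
      using rel[unfolded racah_relation_iff_index[OF mat_diag_dim N], rule_format, OF ij] False N
      by (simp add: mult mult_carrier_mat[of _ n n _ n] del: index_mult_mat(1))
    then have "(t i - t j)^2 * N $$ (i,j) = 2 * (t i + t j) * N $$ (i,j)"
      by Groebner_Basis.algebra
    then have "(t i - t j)^2 = 2 * (t i + t j)" using nz by simp
    then show ?thesis
      using adj[OF ij] adj[OF ij(2,1)] by (simp add: power2_commute add.commute)
  qed simp
  then show ?thesis using N unfolding tridiagonal_def by auto
qed

lemma racah_relation_complement:
  fixes A B C :: "'a :: idom mat"
  assumes car: "A \<in> carrier_mat n n" "B \<in> carrier_mat n n" "C \<in> carrier_mat n n"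
    and sum: "A + B + C = r \<cdot>\<^sub>m 1\<^sub>m n"
    and AB: "racah_relation n A B r s" and BA: "racah_relation n B A r s'"
  shows "racah_relation n C A r (s' - s)"
proof -
  have C: "C = r \<cdot>\<^sub>m 1\<^sub>m n - A - B"
    unfolding sum[symmetric] using car by (intro eq_matI) auto
  note [simp] = car mult_carrier_mat[of _ n n _ n] minus_carrier_mat assoc_mult_mat[of _ n n _ n _ n]
  have left: "C * Y = r \<cdot>\<^sub>m Y - A * Y - B * Y" and right: "Y * C = r \<cdot>\<^sub>m Y - Y * A - Y * B"
    if "Y \<in> carrier_mat n n" for Y
    using that unfolding C
    by (simp_all add: minus_mult_distrib_mat[of _ n n _ _ n] mult_minus_distrib_mat[of _ n n _ n]
        mult_smult_distrib[of _ n n _ n] mult_smult_assoc_mat[of _ n n _ n]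
        right_mult_one_mat[of _ n n] left_mult_one_mat[of _ n n])
  show ?thesis
    unfolding racah_relation_iff_index[OF car(3,1)]
  proof (intro allI impI)
    fix i j assume ij: "i < n" "j < n"
    have words: "(A * (A * B)) $$ (i,j) + (B * (A * A)) $$ (i,j) - 2 * (A * (B * A)) $$ (i,j)
      = 2 * ((A * B) $$ (i,j) + (B * A) $$ (i,j) + (A * A) $$ (i,j) - r * A $$ (i,j)
          + s * 1\<^sub>m n $$ (i,j))"
      "(B * (B * A)) $$ (i,j) + (A * (B * B)) $$ (i,j) - 2 * (B * (A * B)) $$ (i,j)
      = 2 * ((B * A) $$ (i,j) + (A * B) $$ (i,j) + (B * B) $$ (i,j) - r * B $$ (i,j)
          + s' * 1\<^sub>m n $$ (i,j))"
      using AB BA ij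
      unfolding racah_relation_iff_index[OF car(1,2)] racah_relation_iff_index[OF car(2,1)] by blast+
    note expand = left right mult_minus_distrib_mat[of _ n n _ n] mult_smult_distrib[of _ n n _ n]
    note dim = car[THEN carrier_matD(1)] car[THEN carrier_matD(2)]
    have C_index: "C $$ (i,j) = r * 1\<^sub>m n $$ (i,j) - A $$ (i,j) - B $$ (i,j)"
      using ij unfolding C by (simp add: dim)
    show "(C * (C * A)) $$ (i,j) + (A * (C * C)) $$ (i,j) - 2 * (C * (A * C)) $$ (i,j)
      = 2 * ((C * A) $$ (i,j) + (A * C) $$ (i,j) + (C * C) $$ (i,j) - r * C $$ (i,j)
          + (s' - s) * 1\<^sub>m n $$ (i,j))"
      using words ij C_index
      by (simp add: expand dim del: index_mult_mat(1) index_one_mat(1)) Groebner_Basis.algebra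
  qed
qed

definition has_leonard_basis :: "nat \<Rightarrow> complex mat \<Rightarrow> complex mat \<Rightarrow> complex mat \<Rightarrow> bool" where
  "has_leonard_basis n L M N \<longleftrightarrow>
     (\<exists>P Q. basis_change n P Q \<and> diagonal_mat (Q * L * P)
        \<and> irred_tridiagonal (Q * M * P) \<and> irred_tridiagonal (Q * N * P))"

lemma leonard_triple_iff_has_leonard_basis:
  "leonard_triple n L M N \<longleftrightarrow>
     0 < n \<and> has_leonard_basis n L M N \<and> has_leonard_basis n M L N \<and> has_leonard_basis n N L M"
  unfolding leonard_triple_def has_leonard_basis_def by blast

lemma has_leonard_basis_of_racah_relation:
  assumes irr: "irreducible_pair n M N"
    and car: "M \<in> carrier_mat n n" "N \<in> carrier_mat n n" "K \<in> carrier_mat n n"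
    and sum: "M + N + K = k \<cdot>\<^sub>m 1\<^sub>m n" and rel: "racah_relation n M N r s"
    and sim: "similar_mat M (mat_diag n t)"
    and adj: "\<And>i j. i < n \<Longrightarrow> j < n \<Longrightarrow> (t i - t j)^2 = 2 * (t i + t j) \<Longrightarrow> i \<le> j + 1"
  shows "has_leonard_basis n M N K"
proof -
  from sim obtain P Q where PQ: "basis_change n P Q" and QMP: "Q * M * P = mat_diag n t"
    unfolding similar_mat_iff_basis_change[OF car(1)] by (elim exE conjE)
  note conj_car = conjugate_carrier[OF PQ]
  have diag: "diagonal_mat (Q * M * P)" unfolding QMP by (rule diagonal_mat_diag)
  have "racah_relation n (mat_diag n t) (Q * N * P) r s"
    using racah_relation_conjugate[OF PQ car(1,2) rel] unfolding QMP .
  then have "tridiagonal (Q * N * P)"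
    by (rule tridiagonal_of_racah_relation[OF conj_car[OF car(2)] _ adj])
  then have N: "irred_tridiagonal (Q * N * P)"
    by (rule irred_tridiagonal_of_irreducible_pair[OF irr car(1,2) PQ diag])
  have "Q * M * P + Q * N * P + Q * K * P = Q * (M + N + K) * P"
    using car conj_car by (simp flip: conjugate_add[OF PQ])
  also have "\<dots> = k \<cdot>\<^sub>m 1\<^sub>m n"
    unfolding sum by (simp add: conjugate_smult[OF PQ] conjugate_one[OF PQ])
  finally have "irred_tridiagonal (Q * K * P)"
    by (rule irred_tridiagonal_complement[OF car[THEN conj_car] _ diag N])
  with PQ diag N show ?thesis unfolding has_leonard_basis_def by (intro exI conjI)
qed

text \<open>The value of \<^term>\<open>i - 1\<close> at i = 0 is irrelevant in the last assumption, since phi 0 = 0.\<close>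

locale racah_sequences =
  fixes t s \<phi> :: "nat \<Rightarrow> 'a :: idom" and r \<alpha> :: 'a
  assumes \<phi>_0: "\<phi> 0 = 0"
    and t_square: "(t i - t (Suc i))^2 = 2 * (t i + t (Suc i))"
    and s_diff: "s i - 2 * s (Suc i) + s (Suc (Suc i)) = 2"
    and \<phi>_diff: "\<phi> i - 2 * \<phi> (Suc i) + \<phi> (Suc (Suc i))
      = 2 * (t i + t (Suc i)) + 2 * (s i + s (Suc i)) + (t i - t (Suc i)) * (s i - s (Suc i)) - 2 * r"
    and \<phi>_diag: "\<phi> i * (t (i - 1) - t i - 2) + \<phi> (Suc i) * (t (Suc i) - t i - 2)
      = 4 * t i * s i + 2 * t i ^ 2 - 2 * r * t i + 2 * \<alpha>"
begin

lemma bidiag_op_racah_relation: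
  assumes "i < n" and prod: "\<And>i. 0 < i \<Longrightarrow> i < n \<Longrightarrow> u i * v i = \<phi> i" and \<phi>_n: "\<phi> n = 0"
  defines "L \<equiv> lower_bidiag_op t u" and "U \<equiv> upper_bidiag_op n s v"
  shows "L (L (U f)) i + U (L (L f)) i - 2 * L (U (L f)) i
    = 2 * (L (U f) i + U (L f) i + L (L f) i - r * L f i + \<alpha> * f i)"
proof -
  define v' where "v' = (if Suc i < n then v (Suc i) else 0)"
  have top: "U g i = s i * g i + v' * g (Suc i)" for g
    by (simp add: U_def upper_bidiag_op_def v'_def)
  have below: "U g j = s j * g j + v (Suc j) * g (Suc j)" if "j < i" for g j
    using that \<open>i < n\<close> by (simp add: U_def upper_bidiag_op_def)
  have L_0: "L g 0 = t 0 * g 0" and L_Suc: "L g (Suc j) = t (Suc j) * g (Suc j) + u (Suc j) * g j" for g j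
    by (simp_all add: L_def lower_bidiag_op_def)
  have \<phi>_top: "\<phi> (Suc i) = u (Suc i) * v'"
    using prod[of "Suc i"] \<phi>_n \<open>i < n\<close> by (cases "Suc i = n") (auto simp: v'_def)
  consider (zero) "i = 0" | (one) "i = Suc 0" | (ge_two) j where "i = Suc (Suc j)"
    by (metis old.nat.exhaust)
  then show ?thesis
  proof cases
    case zero
    show ?thesis
      using t_square[of 0] \<phi>_diag[of 0]
      unfolding zero diff_0_eq_0 L_0 L_Suc top[unfolded zero] \<phi>_0 \<phi>_top[unfolded zero]
      by Groebner_Basis.algebra
  next
    case one
    then have \<phi>_1: "\<phi> (Suc 0) = u (Suc 0) * v (Suc 0)" using prod \<open>i < n\<close> by simp
    show ?thesis
      using t_square[of "Suc 0"] \<phi>_diag[of "Suc 0", unfolded diff_Suc_1] \<phi>_diff[of 0]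
      unfolding one L_0 L_Suc top[unfolded one] below[unfolded one, OF lessI] \<phi>_0 \<phi>_1 \<phi>_top[unfolded one]
      by Groebner_Basis.algebra
  next
    case ge_two
    then have \<phi>_below: "\<phi> (Suc j) = u (Suc j) * v (Suc j)"
      "\<phi> (Suc (Suc j)) = u (Suc (Suc j)) * v (Suc (Suc j))"
      using prod \<open>i < n\<close> by simp_all
    show ?thesis
      using t_square[of "Suc (Suc j)"] \<phi>_diag[of "Suc (Suc j)", unfolded diff_Suc_1] \<phi>_diff[of "Suc j"]
        s_diff[of j]
      unfolding ge_two L_Suc top[unfolded ge_two] below[unfolded ge_two, OF lessI]
        below[unfolded ge_two, OF less_SucI[OF lessI]] \<phi>_below \<phi>_top[unfolded ge_two]
      by Groebner_Basis.algebra
  qed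
qed

lemma racah_relation_bidiag:
  assumes "\<And>i. 0 < i \<Longrightarrow> i < n \<Longrightarrow> u i * v i = \<phi> i" and "\<phi> n = 0"
  shows "racah_relation n (lower_bidiag n t u) (lower_bidiag n s v)\<^sup>T r \<alpha>"
  unfolding racah_relation_def
proof (rule mat_eq_of_mult_vec[where n = n])
  fix w :: "'a vec" assume "w \<in> carrier_vec n"
  then obtain f where w: "w = vec n f" by (metis carrier_vecD eq_vecI dim_vec index_vec)
  let ?L = "lower_bidiag n t u" and ?U = "(lower_bidiag n s v)\<^sup>T"
  have [simp]: "?U \<in> carrier_mat n n" by simp
  show "(?L * (?L * ?U) + ?U * (?L * ?L) - 2 \<cdot>\<^sub>m (?L * (?U * ?L))) *\<^sub>v w
      = (2 \<cdot>\<^sub>m (?L * ?U + ?U * ?L + ?L * ?L - r \<cdot>\<^sub>m ?L + \<alpha> \<cdot>\<^sub>m 1\<^sub>m n)) *\<^sub>v w"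
    unfolding w using bidiag_op_racah_relation[OF _ assms, where f = f]
    by (simp add: mult_carrier_mat[of _ n n _ n] minus_carrier_mat
        add_mult_distrib_mat_vec[of _ n n] minus_mult_distrib_mat_vec[of _ n n]
        smult_mat_mult_vec[of _ n n] assoc_mult_mat_vec[of _ n n _ n]
        lower_bidiag_mult_vec transpose_lower_bidiag_mult_vec one_mult_mat_vec[of _ n])
      (intro eq_vecI; simp)
qed (simp_all add: mult_carrier_mat[of _ n n _ n] minus_carrier_mat)

end

section \<open>The eigenvalue and superdiagonal sequences\<close>

text \<open>The scalar by which alpha acts; beta acts as \<^term>\<open>- alphaR b a c d\<close>.\<close>

definition alphaR :: "complex \<Rightarrow> complex \<Rightarrow> complex \<Rightarrow> nat \<Rightarrow> complex" where
  "alphaR a b c d = (c - b) * (c + b + 1) * (a - of_nat d / 2) * (a + of_nat d / 2 + 1)"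

lemma theta_diff:
  "theta x d i - theta x d j = (of_nat j - of_nat i) * (2 * x + of_nat d - of_nat i - of_nat j + 1)"
  by (simp add: theta_def field_simps)

lemma theta_Suc_square:
  "(theta x d i - theta x d (Suc i))^2 = 2 * (theta x d i + theta x d (Suc i))"
  by (simp add: theta_def power2_eq_square field_simps)

lemma theta_second_diff: "theta x d i - 2 * theta x d (Suc i) + theta x d (Suc (Suc i)) = 2"
  by (simp add: theta_def field_simps)

lemma phi_second_diff:
  "phi a b c d i - 2 * phi a b c d (Suc i) + phi a b c d (Suc (Suc i))
     = 2 * (theta a d i + theta a d (Suc i)) + 2 * (theta b d i + theta b d (Suc i))
       + (theta a d i - theta a d (Suc i)) * (theta b d i - theta b d (Suc i)) - 2 * deltaR a b c d"
  by (simp add: theta_def phi_def deltaR_def field_simps)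

lemma phi_0 [simp]: "phi a b c d 0 = 0"
  by (simp add: phi_def)

lemma phi_Suc_d [simp]: "phi a b c d (Suc d) = 0"
  by (simp add: phi_def)

lemma phi_swap: "phi b a c d = phi a b c d"
  by (simp add: phi_def add.commute fun_eq_iff)

lemma deltaR_swap: "deltaR b a c d = deltaR a b c d"
  by (simp add: deltaR_def)

lemma phi_diagonal_relation:
  "phi a b c d i * (theta a d (i - 1) - theta a d i - 2)
     + phi a b c d (Suc i) * (theta a d (Suc i) - theta a d i - 2)
   = 4 * theta a d i * theta b d i + 2 * theta a d i ^ 2
     - 2 * deltaR a b c d * theta a d i + 2 * alphaR a b c d"
proof (cases i)
  case 0
  then show ?thesis
    by (simp add: theta_def phi_def deltaR_def alphaR_def power2_eq_square field_simps)
next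
  case (Suc j)
  define D :: complex where "D = of_nat d / 2"
  have "of_nat d = 2 * D" by (simp add: D_def)
  then show ?thesis
    unfolding Suc diff_Suc_1 theta_def phi_def deltaR_def alphaR_def of_nat_Suc D_def[symmetric]
    by Groebner_Basis.algebra
qed

text \<open>The left factor (t_i - t_j)^2 - 2(t_i + t_j), i = k + 1, is (t_i - t_(j+1))(t_i - t_(j-1)); scaling it
  by k - j keeps all indices on the right between j and i.\<close>

lemma theta_square_factorization:
  "(of_nat k - of_nat j) * ((theta x d (Suc k) - theta x d j)^2 - 2 * (theta x d (Suc k) + theta x d j))
   = (of_nat k - of_nat j + 2) * ((theta x d (Suc j) - theta x d (Suc k)) * (theta x d j - theta x d k))"
  by (simp add: theta_def power2_eq_square field_simps)

lemma theta_square_imp_le_Suc: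
  assumes inj: "inj_on (theta x d) {..<d+1}" and "i < d + 1" "j < d + 1"
    and square: "(theta x d i - theta x d j)^2 = 2 * (theta x d i + theta x d j)"
  shows "i \<le> j + 1"
proof (rule ccontr)
  assume "\<not> i \<le> j + 1"
  then obtain k where k: "i = Suc k" "j < k" by (cases i) auto
  then have "theta x d (Suc j) \<noteq> theta x d (Suc k)" "theta x d j \<noteq> theta x d k"
    using inj_onD[OF inj, of "Suc j" "Suc k"] inj_onD[OF inj, of j k] \<open>i < d + 1\<close> by auto
  moreover have "(of_nat (k - j + 2) :: complex) \<noteq> 0" unfolding of_nat_eq_0_iff by simp
  then have "of_nat k - of_nat j + (2::complex) \<noteq> 0" using k by (simp add: of_nat_diff add.commute)
  ultimately show False
    using theta_square_factorization[of k j x d] square by (simp add: k(1))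
qed

lemma inj_on_theta_iff_not_bad_value: "inj_on (theta x d) {..<d+1} \<longleftrightarrow> x \<notin> bad_values d"
proof
  assume inj: "inj_on (theta x d) {..<d+1}"
  show "x \<notin> bad_values d"
  proof
    assume "x \<in> bad_values d"
    then obtain k where k: "x = (of_nat k - of_nat d - 1) / 2" "1 \<le> k" "k + 1 \<le> 2 * d"
      unfolding bad_values_def by auto
    define i where "i = k - d"
    define j where "j = k - i"
    have ij: "i < d + 1" "j < d + 1" "i \<noteq> j" "k = i + j" using k by (auto simp: i_def j_def)
    have "2 * x = of_nat i + of_nat j - of_nat d - 1" using k(1) ij(4) by (simp add: mult.commute)
    then have "theta x d i - theta x d j = 0" unfolding theta_diff by simp
    with inj ij show False by (auto dest: inj_onD)
  qed
next
  assume good: "x \<notin> bad_values d"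
  show "inj_on (theta x d) {..<d+1}"
  proof (rule inj_onI, rule ccontr)
    fix i j assume ij: "i \<in> {..<d+1}" "j \<in> {..<d+1}" "theta x d i = theta x d j" "i \<noteq> j"
    then have "2 * x + of_nat d - of_nat i - of_nat j + 1 = 0"
      using theta_diff[of x d i j] by simp
    then have "x = (of_nat (i + j) - of_nat d - 1) / 2"
      by (simp add: field_simps add_eq_0_iff)
    moreover have "1 \<le> i + j" "i + j + 1 \<le> 2 * d" using ij by auto
    ultimately have "x \<in> bad_values d" unfolding bad_values_def by blast
    with good show False ..
  qed
qed

section \<open>The module R_d(a,b,c)\<close>

lemma racah_sequences_theta_phi:
  "racah_sequences (theta a d) (theta b d) (phi a b c d) (deltaR a b c d) (alphaR a b c d)"
  by unfold_locales
    (rule phi_0 theta_Suc_square theta_second_diff phi_second_diff phi_diagonal_relation)+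

lemma RA_eq_lower_bidiag: "RA a b c d = lower_bidiag (d+1) (theta a d) (\<lambda>_. 1)"
  by (simp add: RA_def lower_bidiag_def)

lemma RB_eq_transpose_lower_bidiag: "RB a b c d = (lower_bidiag (d+1) (theta b d) (phi a b c d))\<^sup>T"
  by (rule eq_matI) (auto simp: RB_def lower_bidiag_def)

lemma R_carrier [simp]:
  "RA a b c d \<in> carrier_mat (d+1) (d+1)" "RB a b c d \<in> carrier_mat (d+1) (d+1)"
  "RC a b c d \<in> carrier_mat (d+1) (d+1)"
  by (auto simp: RA_def RB_def RC_def intro!: minus_carrier_mat)

lemma RA_add_RB_add_RC: "RA a b c d + RB a b c d + RC a b c d = deltaR a b c d \<cdot>\<^sub>m 1\<^sub>m (d+1)"
  by (rule eq_matI) (auto simp: RA_def RB_def RC_def)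

lemma racah_relation_RA_RB:
  "racah_relation (d+1) (RA a b c d) (RB a b c d) (deltaR a b c d) (alphaR a b c d)"
  unfolding RA_eq_lower_bidiag RB_eq_transpose_lower_bidiag
  by (rule racah_sequences.racah_relation_bidiag[OF racah_sequences_theta_phi[where c = c]]) simp_all

lemma racah_relation_RB_RA:
  "racah_relation (d+1) (RB a b c d) (RA a b c d) (deltaR a b c d) (alphaR b a c d)"
proof -
  have "racah_sequences (theta b d) (theta a d) (phi a b c d) (deltaR a b c d) (alphaR b a c d)"
    using racah_sequences_theta_phi[of b d a c] unfolding phi_swap[of b a] deltaR_swap[of b a] .
  then have "racah_relation (d+1) (lower_bidiag (d+1) (theta b d) (phi a b c d))
    (lower_bidiag (d+1) (theta a d) (\<lambda>_. 1))\<^sup>T (deltaR a b c d) (alphaR b a c d)"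
    by (rule racah_sequences.racah_relation_bidiag) simp_all
  from racah_relation_transpose[OF _ _ this] show ?thesis
    unfolding RA_eq_lower_bidiag RB_eq_transpose_lower_bidiag by simp
qed

lemma racah_relation_RC_RA:
  "racah_relation (d+1) (RC a b c d) (RA a b c d) (deltaR a b c d) (alphaR b a c d - alphaR a b c d)"
  by (rule racah_relation_complement[OF R_carrier RA_add_RB_add_RC
        racah_relation_RA_RB racah_relation_RB_RA])

lemma RC_mult_vec:
  "RC a b c d *\<^sub>v vec (d+1) f = vec (d+1) (\<lambda>k. (deltaR a b c d - theta a d k - theta b d k) * f k
     - (if k = 0 then 0 else f (k - 1)) - phi a b c d (Suc k) * f (Suc k))"
proof -
  have "RC a b c d *\<^sub>v vec (d+1) f = deltaR a b c d \<cdot>\<^sub>v vec (d+1) f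
      - vec (d+1) (lower_bidiag_op (theta a d) (\<lambda>_. 1) f)
      - vec (d+1) (upper_bidiag_op (d+1) (theta b d) (phi a b c d) f)"
    unfolding RC_def using R_carrier[of a b c d]
    by (simp add: minus_mult_distrib_mat_vec[of _ "d+1" "d+1"] minus_carrier_mat
        smult_mat_mult_vec[of _ "d+1" "d+1"] one_mult_mat_vec[of _ "d+1"]
        RA_eq_lower_bidiag RB_eq_transpose_lower_bidiag
        lower_bidiag_mult_vec transpose_lower_bidiag_mult_vec)
  also have "\<dots> = vec (d+1) (\<lambda>k. (deltaR a b c d - theta a d k - theta b d k) * f k
     - (if k = 0 then 0 else f (k - 1)) - phi a b c d (Suc k) * f (Suc k))"
    by (intro eq_vecI)
      (auto simp: lower_bidiag_op_def upper_bidiag_op_def less_Suc_eq algebra_simps)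
  finally show ?thesis .
qed

text \<open>Coordinates of the chain w_0 = e_0, w_(i+1) = (C - theta c d i) w_i. The factor with index
  d + 1 vanishes, hence so does w_(d+1).\<close>

definition RC_chain_factor :: "complex \<Rightarrow> nat \<Rightarrow> nat \<Rightarrow> complex" where
  "RC_chain_factor e d h = (of_nat d - of_nat h + 1) * (e + of_nat d / 2 + 2 - of_nat h)"

definition RC_chain :: "complex \<Rightarrow> nat \<Rightarrow> nat \<Rightarrow> nat \<Rightarrow> complex" where
  "RC_chain e d i k = (-1) ^ i * of_nat (i choose k) * (\<Prod>h\<in>{k<..i}. RC_chain_factor e d h)"

lemma phi_Suc_eq_RC_chain_factor:
  "phi a b c d (Suc k)
    = - of_nat (Suc k) * RC_chain_factor (a + b + c) d (Suc k) * (a + b - c + of_nat d / 2 - of_nat k)"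
  by (simp add: phi_def RC_chain_factor_def field_simps)

lemma RC_chain_factor_diff:
  "RC_chain_factor e d k - RC_chain_factor e d (Suc i)
    = (of_nat i + 1 - of_nat k) * (e + 3 * of_nat d / 2 + 2 - of_nat k - of_nat i)"
  by (simp add: RC_chain_factor_def field_simps)

lemma RC_chain_coefficient_identity:
  "deltaR a b c d - theta a d k - theta b d k - theta c d i
     + (of_nat i - of_nat k) * (a + b - c + of_nat d / 2 - of_nat k) + RC_chain_factor (a + b + c) d (Suc i)
    = of_nat k * (a + b + c + 3 * of_nat d / 2 + 2 - of_nat k - of_nat i)"
  by (simp add: deltaR_def theta_def RC_chain_factor_def field_simps)

lemma binomial_pred_mult:
  assumes "k \<le> i"
  shows "(of_nat i + 1 - of_nat k) * (if k = 0 then 0 else of_nat (i choose (k - 1)))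
    = of_nat k * (of_nat (i choose k) :: 'a :: comm_ring_1)"
proof (cases k)
  case (Suc j)
  then have "j \<le> i" using assms by simp
  have "(i - j) * (i choose j) = Suc j * (i choose Suc j)"
    by (simp only: binomial_absorption binomial_absorb_comp)
  then have "of_nat ((i - j) * (i choose j)) = (of_nat (Suc j * (i choose Suc j)) :: 'a)" by simp
  then show ?thesis
    using Suc \<open>j \<le> i\<close> by (simp add: of_nat_diff algebra_simps del: binomial_Suc_Suc)
qed simp

lemma phi_mult_RC_chain:
  assumes "k \<le> i"
  shows "phi a b c d (Suc k) * RC_chain (a + b + c) d i (Suc k)
    = - ((of_nat i - of_nat k) * (a + b - c + of_nat d / 2 - of_nat k) * RC_chain (a + b + c) d i k)"
proof (cases "k = i")
  case True
  then show ?thesis by (simp add: RC_chain_def)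
next
  case False
  define R where "R = (-1) ^ i * (\<Prod>h\<in>{Suc k<..i}. RC_chain_factor (a + b + c) d h)"
  have "{k<..i} = insert (Suc k) {Suc k<..i}" using False assms by auto
  then have "RC_chain (a + b + c) d i k = of_nat (i choose k) * RC_chain_factor (a + b + c) d (Suc k) * R"
    by (simp add: RC_chain_def R_def)
  moreover have "RC_chain (a + b + c) d i (Suc k) = of_nat (i choose Suc k) * R"
    by (simp add: RC_chain_def R_def)
  moreover have "(of_nat i - of_nat k) * of_nat (i choose k)
      = of_nat (Suc k) * (of_nat (i choose Suc k) :: complex)"
    using binomial_pred_mult[of "Suc k" i, where 'a = complex] False assms by simp
  ultimately show ?thesis
    unfolding phi_Suc_eq_RC_chain_factor by Groebner_Basis.algebra
qed

lemma RC_chain_recurrence: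
  "(deltaR a b c d - theta a d k - theta b d k) * RC_chain (a + b + c) d i k
     - (if k = 0 then 0 else RC_chain (a + b + c) d i (k - 1))
     - phi a b c d (Suc k) * RC_chain (a + b + c) d i (Suc k)
    = theta c d i * RC_chain (a + b + c) d i k + RC_chain (a + b + c) d (Suc i) k"
proof -
  let ?w = "RC_chain (a + b + c) d" and ?\<rho> = "RC_chain_factor (a + b + c) d"
  consider (beyond) "Suc i < k" | (new) "k = Suc i" | (within) "k \<le> i" by linarith
  then show ?thesis
  proof cases
    case within
    define R where "R = (-1) ^ i * (\<Prod>h\<in>{k<..i}. ?\<rho> h)"
    define X Y :: complex where "X = of_nat (i choose k)"
      and "Y = (if k = 0 then 0 else of_nat (i choose (k - 1)))"
    have "{k<..Suc i} = insert (Suc i) {k<..i}" using within by auto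
    moreover have "of_nat (Suc i choose k) = X + Y"
      by (cases k) (simp_all add: X_def Y_def)
    ultimately have succ: "?w (Suc i) k = - (X + Y) * ?\<rho> (Suc i) * R"
      by (simp add: RC_chain_def R_def algebra_simps)
    have "{k - 1<..i} = insert k {k<..i}" if "k \<noteq> 0" using that within by auto
    then have pred: "(if k = 0 then 0 else ?w i (k - 1)) = Y * ?\<rho> k * R"
      by (simp add: RC_chain_def R_def Y_def)
    have same: "?w i k = X * R" by (simp add: RC_chain_def R_def X_def)
    have "(of_nat i + 1 - of_nat k) * Y = of_nat k * X"
      unfolding X_def Y_def by (rule binomial_pred_mult[OF within])
    then show ?thesis
      using RC_chain_factor_diff[of "a + b + c" d k i] RC_chain_coefficient_identity[of a b c d k i]
      unfolding phi_mult_RC_chain[OF within] succ pred same by Groebner_Basis.algebra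
  qed (auto simp: RC_chain_def binomial_eq_0)
qed

lemma RC_chain_Suc_d: "k \<le> d \<Longrightarrow> RC_chain e d (Suc d) k = 0"
proof -
  assume "k \<le> d"
  then have "Suc d \<in> {k<..Suc d}" by simp
  moreover have "RC_chain_factor e d (Suc d) = 0" by (simp add: RC_chain_factor_def)
  ultimately have "(\<Prod>h\<in>{k<..Suc d}. RC_chain_factor e d h) = 0" by (intro prod_zero) auto
  then show ?thesis by (simp add: RC_chain_def)
qed

lemma det_RC_chain: "det (mat n n (\<lambda>(k,i). RC_chain e d i k)) \<noteq> 0"
proof -
  let ?P = "mat n n (\<lambda>(k,i). RC_chain e d i k)"
  have "det ?P = prod_list (diag_mat ?P)"
    by (rule det_upper_triangular) (auto simp: RC_chain_def upper_triangular_def)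
  also have "diag_mat ?P = map (\<lambda>i. (-1) ^ i) [0..<n]"
    by (auto simp: diag_mat_def RC_chain_def)
  finally show ?thesis by auto
qed

lemma RC_similar_lower_bidiag:
  "similar_mat (RC a b c d) (lower_bidiag (d+1) (theta c d) (\<lambda>_. 1))"
proof -
  define w where "w = RC_chain (a + b + c) d"
  define P where "P = mat (d+1) (d+1) (\<lambda>(k,i). w i k)"
  have P: "P \<in> carrier_mat (d+1) (d+1)" by (simp add: P_def)
  have det: "det P \<noteq> 0" unfolding P_def w_def by (rule det_RC_chain)
  show ?thesis
  proof (rule similar_lower_bidiag_of_chain[OF R_carrier(3) P det])
    fix i k assume ik: "i < d + 1" "k < d + 1"
    then have "col P i = vec (d+1) (w i)" by (auto simp: P_def)
    then have "(RC a b c d *\<^sub>v col P i) $ k = theta c d i * w i k + w (Suc i) k"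
      using ik RC_chain_recurrence[of a b c d k i, folded w_def] by (simp only: RC_mult_vec index_vec)
    also have "w (Suc i) k = (if Suc i < d + 1 then P $$ (k, Suc i) else 0)"
      using ik RC_chain_Suc_d[of k d "a + b + c"] by (auto simp: P_def w_def less_Suc_eq)
    finally show "(RC a b c d *\<^sub>v col P i) $ k
        = theta c d i * P $$ (k,i) + (if Suc i < d + 1 then P $$ (k, Suc i) else 0)"
      using ik by (simp add: P_def)
  qed
qed

lemma diagonalizable_RA_iff: "diagonalizable (d+1) (RA a b c d) \<longleftrightarrow> a \<notin> bad_values d"
  unfolding RA_eq_lower_bidiag inj_on_theta_iff_not_bad_value[symmetric]
  by (rule diagonalizable_lower_bidiag_iff) simp

lemma diagonalizable_RB_iff:
  assumes "\<forall>i\<in>{0<..<d+1}. phi a b c d i \<noteq> 0"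
  shows "diagonalizable (d+1) (RB a b c d) \<longleftrightarrow> b \<notin> bad_values d"
  unfolding RB_eq_transpose_lower_bidiag diagonalizable_transpose[OF lower_bidiag_carrier]
    inj_on_theta_iff_not_bad_value[symmetric]
  by (rule diagonalizable_lower_bidiag_iff[OF assms])

lemma diagonalizable_RC_iff: "diagonalizable (d+1) (RC a b c d) \<longleftrightarrow> c \<notin> bad_values d"
  unfolding diagonalizable_similar[OF RC_similar_lower_bidiag R_carrier(3) lower_bidiag_carrier]
    inj_on_theta_iff_not_bad_value[symmetric]
  by (rule diagonalizable_lower_bidiag_iff) simp

lemma RA_similar_mat_diag:
  "a \<notin> bad_values d \<Longrightarrow> similar_mat (RA a b c d) (mat_diag (d+1) (theta a d))"
  unfolding RA_eq_lower_bidiag inj_on_theta_iff_not_bad_value[symmetric]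
  by (rule lower_bidiag_similar_mat_diag)

lemma RB_similar_mat_diag:
  assumes "b \<notin> bad_values d"
  shows "similar_mat (RB a b c d) (mat_diag (d+1) (theta b d))"
proof -
  from assms have "similar_mat (lower_bidiag (d+1) (theta b d) (phi a b c d)) (mat_diag (d+1) (theta b d))"
    unfolding inj_on_theta_iff_not_bad_value[symmetric] by (rule lower_bidiag_similar_mat_diag)
  from similar_mat_transpose[OF this] show ?thesis
    unfolding RB_eq_transpose_lower_bidiag transpose_mat_diag .
qed

lemma RC_similar_mat_diag:
  assumes "c \<notin> bad_values d"
  shows "similar_mat (RC a b c d) (mat_diag (d+1) (theta c d))"
  using assms unfolding inj_on_theta_iff_not_bad_value[symmetric]
  by (intro similar_mat_trans[OF RC_similar_lower_bidiag] lower_bidiag_similar_mat_diag)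

lemma R_irreducible_imp_irreducible_pair:
  assumes "R_irreducible a b c d"
  shows "irreducible_pair (d+1) (RA a b c d) (RB a b c d)"
  using assms invariant_under_complement[OF _ R_carrier RA_add_RB_add_RC]
    invariant_under_commutator[OF _ R_carrier(1,2)]
  unfolding irreducible_pair_def R_irreducible_def RDelta_def by blast

lemma R_irreducible_imp_phi_nonzero:
  assumes irr: "R_irreducible a b c d"
  shows "\<forall>i\<in>{0<..<d+1}. phi a b c d i \<noteq> 0"
proof
  fix i assume i: "i \<in> {0<..<d+1}"
  have id_basis: "basis_change (d+1) (1\<^sub>m (d+1)) (1\<^sub>m (d+1))" by (simp add: basis_change_def)
  have "{..<i} \<subset> {..<d+1}" "{..<i} \<noteq> {}" using i by (auto simp: lessThan_strict_subset_iff)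
  from irreducible_pair_off_block_nonzero[OF R_irreducible_imp_irreducible_pair[OF irr]
      R_carrier(1,2) id_basis this]
  obtain k l where k: "k \<in> {..<i}" and l: "l \<in> {..<d+1} - {..<i}"
    and "RA a b c d $$ (k,l) \<noteq> 0 \<or> RB a b c d $$ (k,l) \<noteq> 0"
    unfolding left_mult_one_mat[OF R_carrier(1)] right_mult_one_mat[OF R_carrier(1)]
      left_mult_one_mat[OF R_carrier(2)] right_mult_one_mat[OF R_carrier(2)] by (elim bexE)
  then have "l = k + 1" "phi a b c d l \<noteq> 0"
    by (auto simp: RA_def RB_def split: if_splits)
  moreover from this k l have "l = i" by simp
  ultimately show "phi a b c d i \<noteq> 0" by simp
qed

lemma has_leonard_basis_theta:
  assumes irr: "irreducible_pair (d+1) M N"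
    and car: "M \<in> carrier_mat (d+1) (d+1)" "N \<in> carrier_mat (d+1) (d+1)" "K \<in> carrier_mat (d+1) (d+1)"
    and sum: "M + N + K = k \<cdot>\<^sub>m 1\<^sub>m (d+1)" and rel: "racah_relation (d+1) M N r s"
    and good: "x \<notin> bad_values d" and sim: "similar_mat M (mat_diag (d+1) (theta x d))"
  shows "has_leonard_basis (d+1) M N K"
  by (rule has_leonard_basis_of_racah_relation[OF irr car sum rel sim])
    (rule theta_square_imp_le_Suc[OF good[folded inj_on_theta_iff_not_bad_value]])

lemma leonard_triple_of_not_bad_values:
  assumes "R_irreducible a b c d" and good: "a \<notin> bad_values d" "b \<notin> bad_values d" "c \<notin> bad_values d"
  shows "leonard_triple (d+1) (RA a b c d) (RB a b c d) (RC a b c d)"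
proof -
  let ?A = "RA a b c d" and ?B = "RB a b c d" and ?C = "RC a b c d"
  note A = R_carrier(1)[of a b c d] and B = R_carrier(2)[of a b c d] and C = R_carrier(3)[of a b c d]
  have BAC: "?B + ?A + ?C = deltaR a b c d \<cdot>\<^sub>m 1\<^sub>m (d+1)"
    unfolding comm_add_mat[OF B A] by (rule RA_add_RB_add_RC)
  have CAB: "?C + ?A + ?B = deltaR a b c d \<cdot>\<^sub>m 1\<^sub>m (d+1)"
    unfolding assoc_add_mat[OF C A B] comm_add_mat[OF C add_carrier_mat[OF B, of ?A]]
    by (rule RA_add_RB_add_RC)
  have irr: "irreducible_pair (d+1) ?A ?B"
    by (rule R_irreducible_imp_irreducible_pair[OF assms(1)])
  have "has_leonard_basis (d+1) ?A ?B ?C"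
    by (rule has_leonard_basis_theta[OF irr A B C RA_add_RB_add_RC
          racah_relation_RA_RB good(1) RA_similar_mat_diag[OF good(1)]])
  moreover have "has_leonard_basis (d+1) ?B ?A ?C"
    by (rule has_leonard_basis_theta[OF irreducible_pair_commute[OF irr] B A C BAC
          racah_relation_RB_RA good(2) RB_similar_mat_diag[OF good(2)]])
  moreover have "has_leonard_basis (d+1) ?C ?A ?B"
    by (rule has_leonard_basis_theta[OF irreducible_pair_complement[OF irr A B C CAB] C A B CAB
          racah_relation_RC_RA good(3) RC_similar_mat_diag[OF good(3)]])
  ultimately show ?thesis
    by (simp add: leonard_triple_iff_has_leonard_basis)
qed

lemma leonard_triple_imp_diagonalizable:
  "leonard_triple n L M N \<Longrightarrow> diagonalizable n L \<and> diagonalizable n M \<and> diagonalizable n N"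
  unfolding leonard_triple_def diagonalizable_def by blast

theorem theorem6p9:
  fixes a b c :: complex and d :: nat
  assumes "R_irreducible a b c d"
  shows "(leonard_triple (d+1) (RA a b c d) (RB a b c d) (RC a b c d)
            \<longleftrightarrow> diagonalizable (d+1) (RA a b c d) \<and> diagonalizable (d+1) (RB a b c d)
                \<and> diagonalizable (d+1) (RC a b c d))
       \<and> (diagonalizable (d+1) (RA a b c d) \<and> diagonalizable (d+1) (RB a b c d)
                \<and> diagonalizable (d+1) (RC a b c d)
            \<longleftrightarrow> a \<notin> bad_values d \<and> b \<notin> bad_values d \<and> c \<notin> bad_values d)"
proof -
  have "diagonalizable (d+1) (RB a b c d) \<longleftrightarrow> b \<notin> bad_values d"
    by (rule diagonalizable_RB_iff[OF R_irreducible_imp_phi_nonzero[OF assms]])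
  then show ?thesis
    using leonard_triple_imp_diagonalizable leonard_triple_of_not_bad_values[OF assms]
      diagonalizable_RA_iff diagonalizable_RC_iff by blast
qed

end
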